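(* Let $C_1,C_2>0$, $B\in\mathbb{R}$ and $2/3<\beta\le 1$. There is a constant $\epsilon_0>0$, depending only on $C_1,C_2,B,\beta$, with the following property. Let $0<\alpha<1$ with $\alpha>1-\epsilon_0$, and let $E\subset[0,1]$ be a closed set which supports a probability measure $\mu$ such that (A) $\mu([x,x+\epsilon])\le C_1\epsilon^{\alpha}$ for all $x\in\mathbb{R}$ and all $0<\epsilon\le 1$, (B) $|\widehat{\mu}(k)|\le C_2(1-\alpha)^{-B}|k|^{-\beta/2}$ for all integers $k\neq 0$. Then $E$ contains a non-trivial 3-term arithmetic progression, i.e. there are $x,y\in E$ with $x\ne y$ and $\frac{x+y}{2}\in E$.
   Context: For a measure $\mu$ supported on $[0,1]$ and $k\in\mathbb{Z}$, $\widehat{\mu}(k)=\int_0^1 e^{-2\pi i kx}\,d\mu(x)$. *)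

theory Defs
  imports "HOL-Probability.Probability"
begin

definition fourier_coeff :: "real measure \<Rightarrow> int \<Rightarrow> complex" where
  "fourier_coeff \<mu> k =
     (LINT x:{0..1}|\<mu>. exp (- (2 * complex_of_real pi * \<i> * of_int k * complex_of_real x)))"

text \<open>A Borel probability measure on the line supported on a closed set: as \<open>E\<close> is closed,
  \<open>\<mu> E = 1\<close> says exactly that the topological support of \<open>\<mu>\<close> is contained in \<open>E\<close>; the support
  need not be all of \<open>E\<close>.\<close>

definition supports_prob_measure :: "real set \<Rightarrow> real measure \<Rightarrow> bool" where
  "supports_prob_measure E \<mu> \<longleftrightarrow> prob_space \<mu> \<and> sets \<mu> = sets borel \<and> measure \<mu> E = 1"

definition has_nontrivial_3AP :: "real set \<Rightarrow> bool" where
  "has_nontrivial_3AP E \<longleftrightarrow> (\<exists>x\<in>E. \<exists>y\<in>E. x \<noteq> y \<and> (x + y) / 2 \<in> E)"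

end

theory Submission
  imports Defs "HOL-Real_Asymp.Real_Asymp"
begin

text \<open>
  Suppose that \<open>E\<close> has no non-trivial progression, and put \<open>u = 1 / (1 - \<alpha>)\<close>. The proof compares, at two
  scales, the mass that \<open>\<mu> \<otimes> \<mu> \<otimes> \<mu>\<close> gives to triples with \<open>x + y\<close> close to \<open>2 * z\<close>, measured by the
  Fejer kernel \<open>F\<^sub>n(x + y - 2 * z)\<close>.

  At the scale \<open>1 / N\<close> with \<open>N\<close> of size \<open>exp u\<close> up to a power of \<open>u\<close>, the measure is as good as a
  function with values in \<open>{0..M}\<close>: since \<open>N powr (1 - \<alpha>)\<close> stays bounded, condition (A) bounds the mass of every interval of
  length \<open>1 / N\<close> by \<open>M / N\<close>, where \<open>M\<close> depends on \<open>C\<^sub>1\<close> only. So a positive proportion of these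
  intervals is heavy, Roth's theorem together with Varnavides' averaging argument produces a positive
  proportion of progressions of heavy intervals (\<open>many_progressions_of_dense_set\<close>), and the mass at
  scale \<open>1 / N\<close> is bounded below (\<open>fejer_ap_mass_ge\<close>).

  Between the scales \<open>1 / N\<close> and \<open>1 / n\<close> with \<open>n \<ge> N\<close> the mass hardly changes
  (\<open>fejer_mass_difference\<close>). On the Fourier side the difference is a sum of products of three
  coefficients of \<open>\<mu>\<close>, in which frequencies below \<open>N\<close> are damped. As \<open>3 * \<beta> / 2 > 1\<close>, such sums
  converge with a power of \<open>N\<close> to spare, and this power, exponential in \<open>u\<close>, absorbs every power of
  \<open>u\<close> coming from condition (B).

  As \<open>n\<close> tends to infinity the mass concentrates on triples in \<open>E\<close> with \<open>x + y = 2 * z\<close> modulo \<open>1\<close>, by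
  compactness of \<open>E\<close>. If these were trivial progressions only, a weight vanishing for \<open>x = z\<close> would make
  the limit \<open>0\<close>. The integral Fourier coefficients also see triples that wrap around the circle, where
  \<open>x + y - 2 * z\<close> is a non-zero integer; these have \<open>\<bar>x - z\<bar>\<close> at least as large as the distance of \<open>z\<close>
  from \<open>0\<close> or \<open>1\<close>. The weight \<open>ap_weight m x z\<close> is therefore concentrated on \<open>\<bar>x - z\<bar>\<close> of order
  \<open>m powr (- 1 / 2)\<close> and vanishes for \<open>z = 0\<close> and \<open>z = 1\<close>. With \<open>m = q\<^sup>2\<close> the wrapped triples contribute at
  most a constant times \<open>q powr (- 4)\<close> times the unweighted mass (\<open>fejer_mass_upper_bound\<close>), while
  the lower bound is a constant times \<open>q powr (- 3)\<close>. The unweighted mass is at most a power of \<open>u\<close>, again by the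
  Fourier estimate, so choosing \<open>q\<close> as a larger power of \<open>u\<close> gives a contradiction for large \<open>u\<close>
  (\<open>fejer_masses_incompatible\<close>, \<open>eventually_parameters\<close>).
\<close>

section \<open>Roth's theorem\<close>

text \<open>Integers are used so that translates and reflections of sets need no truncation.\<close>

definition ap_free :: "int set \<Rightarrow> bool" where
  "ap_free A \<longleftrightarrow> (\<forall>a d. 0 < d \<longrightarrow> a \<in> A \<longrightarrow> a + d \<in> A \<longrightarrow> a + 2 * d \<notin> A)"

definition roth_number :: "nat \<Rightarrow> nat" where
  "roth_number n = Max (card ` {A. A \<subseteq> {0..<int n} \<and> ap_free A})"

lemma finite_ap_free_subsets: "finite {A. A \<subseteq> {0..<int n} \<and> ap_free A}"
  by (rule finite_subset[of _ "Pow {0..<int n}"]) auto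

lemma card_le_roth_number:
  assumes "A \<subseteq> {0..<int n}" "ap_free A"
  shows "card A \<le> roth_number n"
  unfolding roth_number_def
  using assms finite_ap_free_subsets by (intro Max_ge) auto

lemma roth_number_attained:
  obtains A where "A \<subseteq> {0..<int n}" "ap_free A" "card A = roth_number n"
proof -
  have "ap_free {}" by (simp add: ap_free_def)
  hence "{A. A \<subseteq> {0..<int n} \<and> ap_free A} \<noteq> {}" by blast
  hence "roth_number n \<in> card ` {A. A \<subseteq> {0..<int n} \<and> ap_free A}"
    unfolding roth_number_def using finite_ap_free_subsets by (intro Max_in) auto
  thus ?thesis using that by auto
qed

lemma card_progression_le_roth_number:
  assumes "ap_free A" "0 < q"
  shows "card (A \<inter> (\<lambda>t. a + q * t) ` {0..<int n}) \<le> roth_number n"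
proof -
  define B where "B = {t \<in> {0..<int n}. a + q * t \<in> A}"
  have "ap_free B"
    unfolding ap_free_def
  proof (intro allI impI notI)
    fix b d assume *: "0 < d" "b \<in> B" "b + d \<in> B" "b + 2 * d \<in> B"
    have "0 < q * d" using * assms by simp
    moreover have "a + q * b \<in> A" "(a + q * b) + q * d \<in> A" "(a + q * b) + 2 * (q * d) \<in> A"
      using * by (auto simp: B_def algebra_simps)
    ultimately show False using assms(1) unfolding ap_free_def by blast
  qed
  hence "card B \<le> roth_number n" by (intro card_le_roth_number) (auto simp: B_def)
  moreover have "A \<inter> (\<lambda>t. a + q * t) ` {0..<int n} = (\<lambda>t. a + q * t) ` B"
    by (auto simp: B_def)
  moreover have "card ((\<lambda>t. a + q * t) ` B) \<le> card B" 
    by (intro card_image_le finite_subset[of B "{0..<int n}"]) (auto simp: B_def)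
  ultimately show ?thesis by simp
qed

text \<open>
  A set with few runs of step \<open>q\<close> can be cut into progressions of length \<open>n0\<close>, up to one incomplete
  progression for each run. On each piece a progression-free set has at most \<open>\<theta> * n0\<close> points, so its
  density on the whole set is at most \<open>\<theta>\<close> up to an error paid per run. The number of runs is counted by
  their first points.\<close>

lemma card_inter_le_of_runs:
  fixes \<theta> :: real and C :: "int set"
  assumes A: "ap_free A" and n0: "0 < n0" "real (roth_number n0) \<le> \<theta> * real n0" and q: "0 < q"
    and C: "finite C"
  shows "real (card (A \<inter> C)) \<le> \<theta> * (real (card C) + real n0 * real (card {u \<in> C. u - q \<notin> C}))"
  using C
proof (induction "card C" arbitrary: C rule: less_induct)
  case less
  have \<theta>: "0 \<le> \<theta>" 
    using n0 by (metis of_nat_0_le_iff of_nat_0_less_iff order_trans zero_le_mult_iff linorder_not_less)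
  show ?case
  proof (cases "C = {}")
    case False
    define u where "u = Min C"
    have uC: "u \<in> C" using False less.prems by (simp add: u_def)
    have usub: "u - q \<notin> C" using q Min_le[OF less.prems, of "u - q"] by (auto simp: u_def)
    define prog where "prog l = (\<lambda>t. u + q * t) ` {0..<int l}" for l
    have prog_mem: "v \<in> prog l \<longleftrightarrow> (\<exists>t. v = u + q * t \<and> 0 \<le> t \<and> t < int l)" for v l
      by (auto simp: prog_def)
    have card_prog: "card (prog l) = l" for l
      using q by (simp add: prog_def card_image inj_on_def)
    have A_prog: "real (card (A \<inter> prog n0)) \<le> \<theta> * real n0"
      using card_progression_le_roth_number[OF A q, of u n0] n0 by (simp add: prog_def)
    define S where "S = {u \<in> C. u - q \<notin> C}"
    have finS: "finite S" using less.prems by (simp add: S_def)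
    have uS: "u \<in> S" using uC usub by (simp add: S_def)
    \<comment> \<open>Remove from \<open>C\<close> the first \<open>l\<close> terms of the run starting at \<open>u\<close>.\<close>
    have step: "real (card (A \<inter> C)) \<le> \<theta> * (real (card C) + real n0 * real (card S))"
      if l: "0 < l" "l \<le> n0" "prog l \<subseteq> C" and full: "l = n0 \<or> u + q * int l \<notin> C" for l
    proof -
      define C' where "C' = C - prog l"
      define S' where "S' = {v \<in> C'. v - q \<notin> C'}"
      have finC': "finite C'" using less.prems by (simp add: C'_def)
      have cC': "real (card C') = real (card C) - real l" "card C' < card C"
        using l less.prems card_prog[of l] card_mono[OF less.prems l(3)]
        by (auto simp: C'_def card_Diff_subset finite_subset[OF l(3)])
      have IH: "real (card (A \<inter> C')) \<le> \<theta> * (real (card C') + real n0 * real (card S'))"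
        using less.hyps[OF cC'(2) finC'] by (simp add: S'_def)
      have "card (A \<inter> C) \<le> card (A \<inter> C') + card (A \<inter> prog l)"
        using card_Un_le[of "A \<inter> C'" "A \<inter> prog l"] Un_absorb1[OF l(3)] Un_absorb2[OF l(3)]
        by (simp add: C'_def Int_Un_distrib[symmetric])
      moreover have "card (A \<inter> prog l) \<le> card (A \<inter> prog n0)"
        using l(2) by (intro card_mono) (auto simp: prog_def)
      ultimately have 1: "real (card (A \<inter> C)) \<le> real (card (A \<inter> C')) + \<theta> * real n0"
        using A_prog by linarith
      have u_prog: "u \<in> prog l" using l(1) unfolding prog_mem by (intro exI[of _ 0]) auto
      have S'_sub: "S' \<subseteq> insert (u + q * int l) (S - {u})"
      proof
        fix v assume "v \<in> S'"
        hence v: "v \<in> C" "v \<notin> prog l" "v - q \<notin> C \<or> v - q \<in> prog l" 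
          by (auto simp: S'_def C'_def)
        show "v \<in> insert (u + q * int l) (S - {u})"
        proof (cases "v - q \<in> prog l")
          case True
          then obtain t where t: "v - q = u + q * t" "0 \<le> t" "t < int l" unfolding prog_mem by blast
          hence "v = u + q * (t + 1)" by (simp add: algebra_simps)
          moreover have "\<not> t + 1 < int l"
          proof
            assume "t + 1 < int l"
            hence "v \<in> prog l" using \<open>v = u + q * (t + 1)\<close> t(2) 
              unfolding prog_mem by (intro exI[of _ "t + 1"]) auto
            thus False using v(2) by blast
          qed
          ultimately have "v = u + q * int l" using t(3) by (metis add.commute linorder_neqE_linordered_idom zless_imp_add1_zle order_le_less)
          thus ?thesis by simp
        next
          case False
          thus ?thesis using v u_prog by (auto simp: S_def)
        qed
      qed
      show ?thesis
      proof (cases "l = n0")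
        case True
        have "card S' \<le> card (insert (u + q * int l) (S - {u}))"
          using S'_sub finS by (intro card_mono) auto
        also have "\<dots> \<le> Suc (card (S - {u}))" by (rule card_insert_le_m1) simp_all
        also have "\<dots> = card S" using uS finS by (metis card_Suc_Diff1)
        finally have "\<theta> * (real n0 * real (card S')) \<le> \<theta> * (real n0 * real (card S))"
          using \<theta> by (intro mult_left_mono) auto
        thus ?thesis using 1 IH cC'(1) True by (simp add: algebra_simps)
      next
        case False
        hence nC: "u + q * int l \<notin> C" using full by simp
        have "S' \<subseteq> S - {u}" using S'_sub nC by (auto simp: S'_def C'_def)
        hence "card S' \<le> card (S - {u})" using finS by (intro card_mono) auto
        hence "real (card S') \<le> real (card S) - 1" using uS finS
          by (metis Diff_subset card_Suc_Diff1 of_nat_Suc add_diff_cancel_left' of_nat_le_iff)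
        hence "\<theta> * (real n0 * real (card S')) \<le> \<theta> * (real n0 * (real (card S) - 1))"
          using \<theta> by (intro mult_left_mono) auto
        moreover have "\<theta> * real (card C') \<le> \<theta> * real (card C)"
          using \<theta> cC' by (intro mult_left_mono) auto
        ultimately show ?thesis using 1 IH by (simp add: algebra_simps)
      qed
    qed
    have "\<exists>l. 0 < l \<and> l \<le> n0 \<and> prog l \<subseteq> C \<and> (l = n0 \<or> u + q * int l \<notin> C)"
    proof (cases "prog n0 \<subseteq> C")
      case True thus ?thesis using n0 by blast
    next
      case False
      then obtain v where "v \<in> prog n0" "v \<notin> C" by blast
      then obtain t0 where t0: "u + q * t0 \<notin> C" "0 \<le> t0" "t0 < int n0" 
        unfolding prog_mem by blast
      hence ex: "u + q * int (nat t0) \<notin> C" by simp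
      define l where "l = (LEAST l. u + q * int l \<notin> C)"
      have l: "u + q * int l \<notin> C" unfolding l_def by (rule LeastI) (rule ex)
      have "l \<le> nat t0" unfolding l_def by (rule Least_le) (rule ex)
      hence "l \<le> n0" using t0 by linarith
      moreover have "0 < l" using l uC by (cases l) auto
      moreover have "prog l \<subseteq> C"
      proof
        fix v assume "v \<in> prog l"
        then obtain t where t: "v = u + q * t" "0 \<le> t" "t < int l" unfolding prog_mem by blast
        hence "nat t < l" by linarith
        hence "u + q * int (nat t) \<in> C" unfolding l_def using not_less_Least by blast
        thus "v \<in> C" using t by simp
      qed
      ultimately show ?thesis using l by blast
    qed
    thus ?thesis using step by (auto simp: S_def)
  qed simp
qed

text \<open>
  The Hilbert cube of all \<open>a + \<Sum>i\<in>I. xs ! i\<close> with \<open>I\<close> a set of indices.\<close>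

fun cube :: "int \<Rightarrow> int list \<Rightarrow> int set" where
  "cube a [] = {a}"
| "cube a (x # xs) = cube a xs \<union> (+) x ` cube a xs"

lemma popular_difference:
  fixes D :: "int set" and g :: nat and \<delta> :: real
  assumes D: "D \<subseteq> {p..<p + int g}" and \<delta>: "0 < \<delta>" "\<delta> * real g \<le> real (card D)" "2 \<le> \<delta> * real g"
  shows "\<exists>x. 0 < x \<and> x < int g \<and> \<delta>\<^sup>2 / 4 * real g \<le> real (card {d \<in> D. d + x \<in> D})"
proof (rule ccontr)
  assume neg: "\<not> ?thesis"
  have finD: "finite D" using D finite_subset by blast
  let ?s = "card D"
  define f where "f x = {d \<in> D. d + x \<in> D}" for x
  \<comment> \<open>There are about \<open>?s\<^sup>2 / 2\<close> increasing pairs and fewer than \<open>g\<close> differences between them.\<close>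
  define W where "W = (SIGMA d:D. {d' \<in> D. d < d'})"
  have g: "0 < g" using \<delta> by (cases g) auto
  have "bij_betw (\<lambda>(x, d). (d, d + x)) (SIGMA x:{0<..<int g}. f x) W"
  proof (rule bij_betwI[where g = "\<lambda>(d, d'). (d' - d, d)"])
    have "d' - d < int g" if "d \<in> D" "d' \<in> D" for d d'
      using subsetD[OF D that(1)] subsetD[OF D that(2)] by auto
    thus "(\<lambda>(d, d'). (d' - d, d)) \<in> W \<rightarrow> (SIGMA x:{0<..<int g}. f x)"
      by (auto simp: W_def f_def)
  qed (auto simp: W_def f_def)
  hence cW: "card W = (\<Sum>x\<in>{0<..<int g}. card (f x))"
    using finD by (subst bij_betw_same_card[symmetric]) (auto simp: f_def)
  define W' where "W' = (SIGMA d:D. {d' \<in> D. d' < d})"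
  have "bij_betw prod.swap W W'"
    by (rule bij_betwI[where g = prod.swap]) (auto simp: W_def W'_def)
  hence cWW': "card W' = card W" using bij_betw_same_card by metis
  have dis: "W \<inter> W' = {}" by (auto simp: W_def W'_def)
  have "D \<times> D = (W \<union> W') \<union> (\<lambda>d. (d, d)) ` D"
    by (auto simp: W_def W'_def)
  hence "card (D \<times> D) \<le> card (W \<union> W') + card ((\<lambda>d. (d, d)) ` D)"
    by (metis card_Un_le)
  also have "card (W \<union> W') \<le> card W + card W'" by (rule card_Un_le)
  also have "card ((\<lambda>d. (d, d)) ` D) \<le> ?s" using finD by (rule card_image_le)
  finally have "?s * ?s \<le> 2 * card W + ?s" using cWW' by (simp add: card_cartesian_product)
  hence 1: "real ?s * real ?s \<le> 2 * real (card W) + real ?s"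
    by (metis of_nat_add of_nat_le_iff of_nat_mult of_nat_numeral)
  have "real (card W) \<le> (\<Sum>x\<in>{0<..<int g}. \<delta>\<^sup>2 / 4 * real g)"
    unfolding cW of_nat_sum using neg by (intro sum_mono) (auto simp: f_def not_le less_imp_le)
  also have "\<dots> = (real g - 1) * (\<delta>\<^sup>2 / 4 * real g)"
    using g by (simp add: of_nat_diff)
  also have "\<dots> < real g * (\<delta>\<^sup>2 / 4 * real g)"
    using g \<delta> by (intro mult_strict_right_mono) auto
  also have "\<dots> = (\<delta> * real g)\<^sup>2 / 4" by (simp add: power2_eq_square)
  also have "\<dots> \<le> (real ?s)\<^sup>2 / 4"
    using \<delta> by (intro divide_right_mono power_mono) auto
  finally have "real ?s * real ?s < (real ?s)\<^sup>2 / 2 + real ?s" using 1 by simp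
  hence "real ?s * real ?s < 2 * real ?s" by (simp add: power2_eq_square)
  moreover have "2 * real ?s \<le> real ?s * real ?s" using \<delta> by (intro mult_right_mono) auto
  ultimately show False by simp
qed

text \<open>
  A popular difference \<open>x\<close> of \<open>D\<close> leaves a set of points \<open>d\<close> with \<open>d, d + x \<in> D\<close> that is still dense
  in the same interval; a cube inside that set extends by \<open>x\<close> to a cube inside \<open>D\<close>.\<close>

lemma dense_set_contains_cube:
  fixes \<delta> :: real
  assumes "0 < \<delta>"
  shows "\<exists>G::nat. \<forall>g\<ge>G. \<forall>p D. D \<subseteq> {p..<p + int g} \<longrightarrow> \<delta> * real g \<le> real (card D) \<longrightarrow>
           (\<exists>a xs. length xs = k \<and> (\<forall>x\<in>set xs. 0 < x \<and> x < int g) \<and> cube a xs \<subseteq> D)"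
  using assms
proof (induction k arbitrary: \<delta>)
  case 0
  have ne: "\<exists>a. a \<in> D" if "1 \<le> g" "\<delta> * real g \<le> real (card D)" for g and D :: "int set"
  proof -
    have "0 < \<delta> * real g" using that 0 by simp
    hence "D \<noteq> {}" using that(2) by auto
    thus ?thesis by blast
  qed
  show ?case
  proof (intro exI[of _ "1::nat"] allI impI)
    fix g :: nat and p :: int and D :: "int set" assume "1 \<le> g" "\<delta> * real g \<le> real (card D)"
    from ne[OF this] obtain a where "a \<in> D" ..
    hence "length ([]::int list) = 0 \<and> (\<forall>x\<in>set ([]::int list). 0 < x \<and> x < int g) \<and> cube a [] \<subseteq> D" by simp
    thus "\<exists>a xs. length xs = 0 \<and> (\<forall>x\<in>set xs. 0 < x \<and> x < int g) \<and> cube a xs \<subseteq> D"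
      by (intro exI[of _ a] exI[of _ "[] :: int list"])
  qed
next
  case (Suc k)
  have "0 < \<delta>\<^sup>2 / 4" using Suc.prems by simp
  from Suc.IH[OF this] obtain G :: nat where G: "\<forall>g\<ge>G. \<forall>p D. D \<subseteq> {p..<p + int g} \<longrightarrow> 
      \<delta>\<^sup>2 / 4 * real g \<le> real (card D) \<longrightarrow>
           (\<exists>a xs. length xs = k \<and> (\<forall>x\<in>set xs. 0 < x \<and> x < int g) \<and> cube a xs \<subseteq> D)"
    ..
  show ?case
  proof (intro exI[of _ "max G (nat \<lceil>2 / \<delta>\<rceil>)"] allI impI)
    fix g p D assume g: "max G (nat \<lceil>2 / \<delta>\<rceil>) \<le> g" and D: "D \<subseteq> {p..<p + int g}" 
      and card: "\<delta> * real g \<le> real (card D)"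
    have "2 / \<delta> \<le> real g" using g by linarith
    hence "2 \<le> \<delta> * real g" using Suc.prems by (simp add: field_simps)
    from popular_difference[OF D Suc.prems card this] obtain x where
      x: "0 < x" "x < int g" "\<delta>\<^sup>2 / 4 * real g \<le> real (card {d \<in> D. d + x \<in> D})" by blast
    have "{d \<in> D. d + x \<in> D} \<subseteq> {p..<p + int g}" using D by auto
    moreover have "G \<le> g" using g by simp
    ultimately obtain a xs where xs:
      "length xs = k" "\<forall>x\<in>set xs. 0 < x \<and> x < int g" "cube a xs \<subseteq> {d \<in> D. d + x \<in> D}" 
      using G x(3) by meson
    have "length (x # xs) = Suc k \<and> (\<forall>x\<in>set (x # xs). 0 < x \<and> x < int g) \<and> cube a (x # xs) \<subseteq> D"
      using xs x by (auto simp: add.commute)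
    thus "\<exists>a xs. length xs = Suc k \<and> (\<forall>x\<in>set xs. 0 < x \<and> x < int g) \<and> cube a xs \<subseteq> D"
      by (intro exI[of _ a] exI[of _ "x # xs"])
  qed
qed

text \<open>
  If \<open>H\<close> and \<open>B\<close> lie in a progression-free set and \<open>B\<close> lies to the left of \<open>H\<close>, these are points which
  the set has to avoid.\<close>

definition reflections :: "int set \<Rightarrow> int set \<Rightarrow> int set" where
  "reflections H B = (\<lambda>(h, b). 2 * h - b) ` (H \<times> B)"

lemma reflections_cube_Cons:
  "reflections (cube a (x # xs)) B = reflections (cube a xs) B \<union> (+) (2 * x) ` reflections (cube a xs) B"
proof -
  have "reflections ((+) x ` cube a xs) B = (+) (2 * x) ` reflections (cube a xs) B"
    by (force simp: reflections_def image_iff algebra_simps)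
  thus ?thesis by (simp add: reflections_def image_Un Sigma_Un_distrib1 del: image_add_0)
qed

lemma finite_cube [simp]: "finite (cube a xs)" by (induction xs) auto

text \<open>
  Along the chain of subcubes the sets of reflections increase, so one of the \<open>length xs\<close> steps adds at
  most the average. At such a step the smaller set is nearly invariant under translation by \<open>2 * x\<close>.\<close>

lemma slow_growth:
  assumes "finite B" "xs \<noteq> []"
  shows "\<exists>x ys. x \<in> set xs \<and> cube a (x # ys) \<subseteq> cube a xs \<and>
     card (reflections (cube a (x # ys)) B - reflections (cube a ys) B) * length xs 
       \<le> card (reflections (cube a xs) B)"
  using assms(2)
proof (induction xs)
  case (Cons z zs)
  let ?N = "\<lambda>ys. reflections (cube a ys) B"
  have fin: "finite (?N ys)" for ys using assms(1) by (simp add: reflections_def)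
  let ?d = "card (?N (z # zs) - ?N zs)"
  have sub: "?N zs \<subseteq> ?N (z # zs)" unfolding reflections_cube_Cons by blast
  have d: "?d + card (?N zs) = card (?N (z # zs))"
    using card_Diff_subset[OF fin sub] card_mono[OF fin sub] by linarith
  show ?case
  proof (cases "?d * length (z # zs) \<le> card (?N (z # zs))")
    case True
    thus ?thesis by (intro exI[of _ z] exI[of _ zs] conjI list.set_intros order_refl)
  next
    case False
    hence ne: "zs \<noteq> []" using d by (auto simp del: cube.simps)
    from Cons.IH[OF this] obtain x ys where IH: "x \<in> set zs" "cube a (x # ys) \<subseteq> cube a zs"
      "card (?N (x # ys) - ?N ys) * length zs \<le> card (?N zs)" by blast
    let ?e = "card (?N (x # ys) - ?N ys)" and ?l = "length zs" and ?n = "card (?N (z # zs))"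
    have "?e * ?l + ?d \<le> ?n" using IH(3) d by simp
    have "?e < ?d \<or> ?e * (?l + 1) \<le> ?n"
    proof (rule disjCI)
      assume "\<not> ?e * (?l + 1) \<le> ?n"
      hence 1: "?n < ?e * (?l + 1)" by simp
      have 2: "?n < ?d * (?l + 1)" using False by (simp del: cube.simps)
      show "?e < ?d"
      proof (rule ccontr)
        assume "\<not> ?e < ?d"
        hence "?d * ?l \<le> ?e * ?l" by (intro mult_right_mono) auto
        thus False using 2 \<open>?e * ?l + ?d \<le> ?n\<close> by (simp only: distrib_left mult_1_right)
      qed
    qed
    moreover have "?e * (?l + 1) \<le> ?n" if "?e < ?d"
      using \<open>?e * ?l + ?d \<le> ?n\<close> that by (simp del: cube.simps)
    ultimately have "?e * length (z # zs) \<le> ?n" by (auto simp del: cube.simps)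
    moreover have "cube a zs \<subseteq> cube a (z # zs)" by simp
    ultimately have "x \<in> set (z # zs) \<and> cube a (x # ys) \<subseteq> cube a (z # zs) \<and> 
      ?e * length (z # zs) \<le> ?n" using IH(1,2) by (meson list.set_intros(2) order_trans)
    thus ?thesis by blast
  qed
qed simp

lemma card_reflections_ge:
  assumes "finite H" "finite B" "H \<noteq> {}"
  shows "card B \<le> card (reflections H B)"
proof -
  obtain h where h: "h \<in> H" using assms by blast
  have "inj_on (\<lambda>b. 2 * h - b) B" by (auto simp: inj_on_def)
  hence "card B = card ((\<lambda>b. 2 * h - b) ` B)" by (simp add: card_image)
  also have "\<dots> \<le> card (reflections H B)"
    using assms h by (intro card_mono) (auto simp: reflections_def)
  finally show ?thesis .
qed

lemma cube_nonempty: "cube a xs \<noteq> {}" by (induction xs) auto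

text \<open>An extremal set cannot be too dense outside an interval, so it is not too thin inside.\<close>

lemma card_inter_interval_ge:
  fixes \<theta> c :: real
  assumes A: "ap_free A" "A \<subseteq> {0..<int n}" "c * real n \<le> real (card A)"
    and n0: "0 < n0" "real (roth_number n0) \<le> \<theta> * real n0" 
    and I: "0 \<le> s" "s \<le> t" "t \<le> int n"
  shows "c * real n - \<theta> * (real n - real_of_int (t - s) + 2 * real n0) \<le> real (card (A \<inter> {s..<t}))"
proof -
  define C where "C = {0..<int n} - {s..<t}"
  have finC: "finite C" by (simp add: C_def)
  have \<theta>: "0 \<le> \<theta>" 
    using n0 by (metis of_nat_0_le_iff of_nat_0_less_iff order_trans zero_le_mult_iff linorder_not_less)
  have "card C = card {0..<int n} - card {s..<t}"
    unfolding C_def using I by (intro card_Diff_subset) auto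
  hence cC: "real (card C) = real n - real_of_int (t - s)"
    using I by (simp add: of_nat_diff nat_le_iff)
  have "card {u \<in> C. u - 1 \<notin> C} \<le> card {0, t}"
    using I by (intro card_mono) (auto simp: C_def)
  also have "\<dots> \<le> 2" by (simp add: card_insert_le_m1)
  finally have st: "real (card {u \<in> C. u - 1 \<notin> C}) \<le> 2" by simp
  have "real (card (A \<inter> C)) \<le> \<theta> * (real (card C) + real n0 * real (card {u \<in> C. u - 1 \<notin> C}))"
    by (rule card_inter_le_of_runs[OF A(1) n0 _ finC]) simp
  also have "\<dots> \<le> \<theta> * (real (card C) + real n0 * 2)"
    using st \<theta> by (intro mult_left_mono add_left_mono) auto
  finally have 1: "real (card (A \<inter> C)) \<le> \<theta> * (real n - real_of_int (t - s) + 2 * real n0)"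
    unfolding cC by (simp add: mult.commute)
  have "A = (A \<inter> C) \<union> (A \<inter> {s..<t})" using A(2) by (auto simp: C_def)
  hence "card A \<le> card (A \<inter> C) + card (A \<inter> {s..<t})" by (metis card_Un_le)
  hence "real (card A) \<le> real (card (A \<inter> C)) + real (card (A \<inter> {s..<t}))" by linarith
  thus ?thesis using 1 A(3) by linarith
qed

lemma dense_block:
  fixes A :: "int set" and \<delta> :: real
  assumes "\<delta> * real K * real g \<le> real (card (A \<inter> {int (K * g)..<int (2 * K * g)}))" "0 < K"
  shows "\<exists>j<K. \<delta> * real g \<le> real (card (A \<inter> {int ((K + j) * g)..<int ((K + j) * g) + int g}))"
proof (rule ccontr)
  assume neg: "\<not> ?thesis"
  define I where "I j = {int ((K + j) * g)..<int ((K + j) * g) + int g}" for j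
  have "{int (K * g)..<int ((K + j) * g)} \<subseteq> (\<Union>i<j. I i)" for j
  proof (induction j)
    case (Suc j)
    have "{int (K * g)..<int ((K + Suc j) * g)} \<subseteq> {int (K * g)..<int ((K + j) * g)} \<union> I j"
      by (auto simp: I_def algebra_simps)
    thus ?case using Suc by (auto simp: lessThan_Suc)
  qed auto
  from this[of K] have "{int (K * g)..<int (2 * K * g)} \<subseteq> (\<Union>i<K. I i)"
    unfolding mult_2 .
  hence "A \<inter> {int (K * g)..<int (2 * K * g)} \<subseteq> (\<Union>i<K. A \<inter> I i)" by blast
  hence "card (A \<inter> {int (K * g)..<int (2 * K * g)}) \<le> card (\<Union>i<K. A \<inter> I i)"
    by (intro card_mono) (auto simp: I_def)
  also have "\<dots> \<le> (\<Sum>i<K. card (A \<inter> I i))" by (rule card_UN_le) simp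
  finally have "real (card (A \<inter> {int (K * g)..<int (2 * K * g)})) \<le> (\<Sum>i<K. real (card (A \<inter> I i)))"
    by (metis of_nat_le_iff of_nat_sum)
  also have "\<dots> < (\<Sum>i<K. \<delta> * real g)"
    using neg assms(2) by (intro sum_strict_mono) (auto simp: I_def not_le)
  finally show False using assms(1) by (simp add: mult_ac)
qed

text \<open>
  Szemeredi's combinatorial proof. Let \<open>c\<close> be the limiting density of extremal progression-free sets and
  suppose \<open>c > 0\<close>. An extremal set \<open>A\<close> has density nearly \<open>c\<close> on every long interval and at most
  slightly more than \<open>c\<close> on every set with few runs of some step. A Hilbert cube in the middle of \<open>A\<close>
  reflects the left part of \<open>A\<close> into a set \<open>N\<close> disjoint from \<open>A\<close>. By \<open>slow_growth\<close>, a subcube can be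
  chosen for which \<open>N\<close>, and so its complement, has few runs. Then \<open>A\<close> has density
  at most slightly more than \<open>c\<close> on the complement and misses \<open>N\<close>, which is too little for its density
  on the whole interval.\<close>

lemma roth_theorem:
  fixes \<delta> :: real
  assumes \<delta>: "0 < \<delta>"
  shows "\<exists>L>0. \<forall>A. A \<subseteq> {0..<int L} \<longrightarrow> \<delta> * real L \<le> real (card A) \<longrightarrow> \<not> ap_free A"
proof (rule ccontr)
  assume neg: "\<not> ?thesis"
  define c where "c = (INF n\<in>{1..}. real (roth_number n) / real n)"
  have bdd: "bdd_below ((\<lambda>n. real (roth_number n) / real n) ` {1..})"
    by (intro bdd_belowI2[where m = 0]) auto
  have c_le: "c * real n \<le> real (roth_number n)" if "0 < n" for n
  proof -
    have "c \<le> real (roth_number n) / real n" unfolding c_def using that by (intro cINF_lower[OF bdd]) auto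
    thus ?thesis using that by (simp add: field_simps)
  qed
  have "\<delta> \<le> c" unfolding c_def
  proof (rule cINF_greatest)
    fix n :: nat assume n: "n \<in> {1..}"
    hence "0 < n" by simp
    with neg obtain A where "A \<subseteq> {0..<int n}" "\<delta> * real n \<le> real (card A)" "ap_free A" by blast
    with card_le_roth_number have "\<delta> * real n \<le> real (roth_number n)" 
      by (meson of_nat_le_iff order_trans)
    thus "\<delta> \<le> real (roth_number n) / real n" using n by (simp add: field_simps)
  qed auto
  hence c: "0 < c" using \<delta> by simp
  obtain A1 where "A1 \<subseteq> {0..<int 1}" "card A1 = roth_number 1" by (rule roth_number_attained)
  hence "roth_number 1 \<le> 1" using card_mono[of "{0..<int 1}" A1] by simp
  hence c1: "c \<le> 1" using c_le[of 1] by simp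
  \<comment> \<open>Reflections of \<open>A\<close> will occupy about \<open>c * n / 4\<close> places that \<open>A\<close> has to avoid, which is a margin
    of \<open>c\<^sup>2 * n / 4\<close>; all errors are kept below it. The order of choice is \<open>\<epsilon>\<close>, then \<open>n0\<close>, then \<open>K\<close>,
    then the block length \<open>g\<close>.\<close>
  define \<epsilon> where "\<epsilon> = c\<^sup>2 / 24"
  define \<theta> where "\<theta> = c + \<epsilon>"
  have csq: "0 < c\<^sup>2" "c\<^sup>2 \<le> c" using c c1 by (auto simp: power2_eq_square mult_le_cancel_left1)
  have \<epsilon>: "0 < \<epsilon>" using csq by (simp add: \<epsilon>_def)
  have \<theta>: "0 < \<theta>" "\<theta> \<le> 2" using c c1 csq unfolding \<theta>_def \<epsilon>_def by linarith+
  have "c < \<theta>" using \<epsilon> by (simp add: \<theta>_def)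
  then obtain n0 where "n0 \<in> {1..}" "real (roth_number n0) / real n0 < \<theta>"
    unfolding c_def using cINF_less_iff[OF _ bdd] by auto
  hence n0: "0 < n0" "real (roth_number n0) \<le> \<theta> * real n0" by (auto simp: field_simps)
  define K where "K = nat \<lceil>48 * real n0 / c\<^sup>2\<rceil>"
  have K: "48 * real n0 / c\<^sup>2 \<le> real K" unfolding K_def by linarith
  hence "0 < real K" using n0 csq by (smt (verit) divide_pos_pos of_nat_0_less_iff mult_pos_pos)
  hence K0: "0 < K" by simp
  have K': "48 * real n0 \<le> c\<^sup>2 * real K" using K csq by (simp add: field_simps)
  have "0 < c / 2" using c by simp
  from dense_set_contains_cube[OF this, of K] obtain G :: nat 
    where G: "\<forall>g\<ge>G. \<forall>p D. D \<subseteq> {p..<p + int g} \<longrightarrow> c / 2 * real g \<le> real (card D) \<longrightarrow>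
           (\<exists>a xs. length xs = K \<and> (\<forall>x\<in>set xs. 0 < x \<and> x < int g) \<and> cube a xs \<subseteq> D)" ..
  define g where "g = max G 2"
  have g: "G \<le> g" "2 \<le> g" by (auto simp: g_def)
  define n where "n = 4 * K * g"
  have n: "real n = 4 * real K * real g" "0 < n" using g K0 by (auto simp: n_def)
  have n1: "192 * real n0 * real g \<le> c\<^sup>2 * real n" 
    using mult_right_mono[OF K', of "4 * real g"] by (simp add: n algebra_simps)
  have "192 * real n0 * 2 \<le> 192 * real n0 * real g" using g by (intro mult_left_mono) auto
  with n1 have n2: "384 * real n0 \<le> c\<^sup>2 * real n" by linarith
  obtain A where A: "A \<subseteq> {0..<int n}" "ap_free A" "card A = roth_number n" by (rule roth_number_attained)
  have cA: "c * real n \<le> real (card A)" using c_le[OF n(2)] A by simp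
  have interval: "c * real_of_int (t - s) - \<epsilon> * real n - 4 * real n0 \<le> real (card (A \<inter> {s..<t}))" 
    if I: "0 \<le> s" "s \<le> t" "t \<le> int n" for s t
  proof -
    have "0 \<le> \<epsilon> * real_of_int (t - s)" using \<epsilon> I by simp
    moreover have "\<theta> * real n0 \<le> 2 * real n0" using \<theta> by (intro mult_right_mono) auto
    ultimately show ?thesis
      using card_inter_interval_ge[OF A(2,1) cA n0 I] by (simp add: \<theta>_def algebra_simps)
  qed
  \<comment> \<open>Density is only controlled up to an error \<open>\<epsilon> * n\<close>, far more than the length \<open>g\<close> of a block, so
    the block has to be chosen by averaging over the second quarter of the interval.\<close>
  have \<epsilon>n: "\<epsilon> * real n = c\<^sup>2 * real n / 24" by (simp add: \<epsilon>_def)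
  have ccn: "c\<^sup>2 * real n \<le> c * real n" using csq by (intro mult_right_mono) auto
  have "real_of_int (int (2 * K * g) - int (K * g)) = real n / 4" "c / 2 * real K * real g = c * real n / 8"
    by (simp_all add: n)
  moreover have "c * real n / 8 \<le> c * (real n / 4) - \<epsilon> * real n - 4 * real n0"
    using n2 ccn unfolding \<epsilon>n by linarith
  ultimately have "c / 2 * real K * real g \<le> c * real_of_int (int (2 * K * g) - int (K * g)) - \<epsilon> * real n - 4 * real n0"
    by presburger
  also have "\<dots> \<le> real (card (A \<inter> {int (K * g)..<int (2 * K * g)}))"
    by (rule interval) (auto simp: n_def)
  finally have "c / 2 * real K * real g \<le> real (card (A \<inter> {int (K * g)..<int (2 * K * g)}))" .
  from dense_block[OF this K0] obtain j where j: "j < K" 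
    "c / 2 * real g \<le> real (card (A \<inter> {int ((K + j) * g)..<int ((K + j) * g) + int g}))"
    by blast
  define p where "p = int ((K + j) * g)"
  have "\<exists>a xs. length xs = K \<and> (\<forall>x\<in>set xs. 0 < x \<and> x < int g) \<and> cube a xs \<subseteq> A \<inter> {p..<p + int g}"
    by (rule G[rule_format, OF g(1) inf_le2]) (use j(2) in \<open>simp only: p_def\<close>)
  then obtain a xs where xs: "length xs = K" "\<forall>x\<in>set xs. 0 < x \<and> x < int g" 
    "cube a xs \<subseteq> A \<inter> {p..<p + int g}" by (elim exE conjE)
  have p: "0 \<le> p" "int K * int g \<le> p" "2 * p + 2 * int g \<le> int n"
  proof -
    have "Suc j * g \<le> K * g" using j(1) by (intro mult_right_mono) auto
    hence "2 * ((K + j) * g) + 2 * g \<le> n" by (simp add: n_def algebra_simps)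
    thus "2 * p + 2 * int g \<le> int n" unfolding p_def by linarith
  qed (auto simp: p_def algebra_simps)
  define B where "B = A \<inter> {0..<p}"
  define T where "T = {p..<2 * p + 2 * int g}"
  have finB: "finite B" by (simp add: B_def)
  have "xs \<noteq> []" using xs(1) K0 by auto
  from slow_growth[OF finB this, of a] obtain x ys where ys: "x \<in> set xs" "cube a (x # ys) \<subseteq> cube a xs"
    "card (reflections (cube a (x # ys)) B - reflections (cube a ys) B) * length xs 
       \<le> card (reflections (cube a xs) B)" by blast
  define N where "N = reflections (cube a ys) B"
  define N' where "N' = reflections (cube a (x # ys)) B"
  have N'_eq: "N' = N \<union> (+) (2 * x) ` N" unfolding N_def N'_def by (rule reflections_cube_Cons)
  \<comment> \<open>If \<open>b < h\<close> both lie in \<open>A\<close> then the reflection \<open>2 * h - b\<close> completes a progression.\<close>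
  have refl_T: "reflections (cube a zs) B \<subseteq> T - A" if "cube a zs \<subseteq> cube a xs" for zs
  proof
    fix v assume "v \<in> reflections (cube a zs) B"
    then obtain h b where hb: "v = 2 * h - b" "h \<in> cube a zs" "b \<in> B" by (auto simp: reflections_def)
    have h: "h \<in> A" "p \<le> h" "h < p + int g" using hb that xs(3) by auto
    have b: "b \<in> A" "0 \<le> b" "b < p" using hb by (auto simp: B_def)
    have "b + 2 * (h - b) \<notin> A"       using A(2)[unfolded ap_free_def, rule_format, of "h - b" b] h b by simp
    moreover have "b + 2 * (h - b) = v" using hb(1) by simp
    ultimately have "v \<notin> A" by simp
    moreover have "v \<in> T" unfolding T_def hb(1) using h b by simp
    ultimately show "v \<in> T - A" by blast
  qed
  have N_T: "N \<subseteq> T" "A \<inter> N = {}" and N'_T: "N' \<subseteq> T"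
  proof -
    have "cube a ys \<subseteq> cube a xs" using ys(2) by simp
    from refl_T[OF this] show "N \<subseteq> T" "A \<inter> N = {}" unfolding N_def by blast+
    from refl_T[OF ys(2)] show "N' \<subseteq> T" unfolding N'_def by blast
  qed
  have finT: "finite T" by (simp add: T_def)
  have cT: "real (card T) = real_of_int (2 * p + 2 * int g - p)" using p by (simp add: T_def)
  have cT_n: "real (card T) \<le> real n"
  proof -
    have "2 * p + 2 * int g - p \<le> int n" using p by linarith
    thus ?thesis unfolding cT by linarith
  qed
  have diff: "real (card (N' - N)) * real K \<le> real n"
  proof -
    have "card (reflections (cube a xs) B) \<le> card T"
      using refl_T[of xs] finT by (intro card_mono) auto
    hence "card (N' - N) * K \<le> card T" using ys(3) xs(1) by (simp add: N_def N'_def del: cube.simps)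
    hence "real (card (N' - N) * K) \<le> real (card T)" unfolding of_nat_le_iff .
    thus ?thesis using cT_n by simp
  qed
  define C where "C = T - N"
  have finC: "finite C" using finT by (simp add: C_def)
  have x: "0 < x" "x < int g" using xs(2) ys(1) by auto
  \<comment> \<open>A run in \<open>C\<close> with step \<open>2 * x\<close> starts at the left end of \<open>T\<close> or just after a point of \<open>N\<close>.\<close>
  have "{u \<in> C. u - 2 * x \<notin> C} \<subseteq> {p..<p + 2 * x} \<union> (N' - N)"
  proof
    fix u assume "u \<in> {u \<in> C. u - 2 * x \<notin> C}"
    hence u: "u \<in> T" "u \<notin> N" "u - 2 * x \<notin> T \<or> u - 2 * x \<in> N" by (auto simp: C_def)
    have "u \<in> (+) (2 * x) ` N" if "u - 2 * x \<in> N" 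
      using that by (intro image_eqI[of _ _ "u - 2 * x"]) auto
    thus "u \<in> {p..<p + 2 * x} \<union> (N' - N)" using u x unfolding N'_eq by (auto simp: T_def)
  qed
  hence "card {u \<in> C. u - 2 * x \<notin> C} \<le> card ({p..<p + 2 * x} \<union> (N' - N))"
    using finite_subset[OF N'_T finT] by (intro card_mono) auto
  also have "\<dots> \<le> card {p..<p + 2 * x} + card (N' - N)" by (rule card_Un_le)
  also have "\<dots> \<le> 2 * g + card (N' - N)" using x by simp
  finally have starts: "real (card {u \<in> C. u - 2 * x \<notin> C}) \<le> 2 * real g + real (card (N' - N))"
    by linarith
  have cC: "real (card C) = real (card T) - real (card N)"
    unfolding C_def using N_T(1) finT 
    by (simp add: card_Diff_subset finite_subset card_mono of_nat_diff)
  have "A \<inter> T = A \<inter> C" using N_T(2) by (auto simp: C_def)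
  hence "real (card (A \<inter> T)) \<le> \<theta> * (real (card C) + real n0 * real (card {u \<in> C. u - 2 * x \<notin> C}))"
    using card_inter_le_of_runs[OF A(2) n0 _ finC, of "2 * x"] x(1) by simp
  also have "\<dots> \<le> \<theta> * (real (card C) + real n0 * (2 * real g + real (card (N' - N))))"
    using starts \<theta> by (intro mult_left_mono add_left_mono) auto
  finally have up: "real (card (A \<inter> T)) \<le> 
      \<theta> * (real (card T) - real (card N)) + \<theta> * (real n0 * (2 * real g + real (card (N' - N))))"
    unfolding cC by (simp add: algebra_simps)
  have lo: "c * real (card T) - \<epsilon> * real n - 4 * real n0 \<le> real (card (A \<inter> T))"
    using interval[of p "2 * p + 2 * int g"] p unfolding cT T_def[symmetric] by linarith
  have "card B \<le> card N" unfolding N_def using finB cube_nonempty by (intro card_reflections_ge) auto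
  moreover have "c * real_of_int (p - 0) - \<epsilon> * real n - 4 * real n0 \<le> real (card B)"
    unfolding B_def by (rule interval) (use p in auto)
  ultimately have cN: "c * real_of_int p - \<epsilon> * real n - 4 * real n0 \<le> real (card N)" by simp
  have "real K * real g \<le> real_of_int p"   proof -
    have "real_of_int (int K * int g) \<le> real_of_int p" using p(2) unfolding of_int_le_iff .
    thus ?thesis by simp
  qed
  hence "c * (real n / 4) \<le> c * real_of_int p" using c n by (intro mult_left_mono) auto
  hence cN': "c * (real n / 4) - \<epsilon> * real n - 4 * real n0 \<le> real (card N)" using cN by linarith
  \<comment> \<open>Upper and lower bounds for \<open>A \<inter> T\<close> now force \<open>N\<close>, and with it \<open>B\<close>, to be too small.\<close>
  have e1: "c * (c * (real n / 4) - \<epsilon> * real n - 4 * real n0) \<le> c * real (card N)"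
    using cN' c by (intro mult_left_mono) auto
  have e2: "\<theta> * (real n0 * (2 * real g + real (card (N' - N)))) \<le> 2 * (real n0 * (2 * real g + real (card (N' - N))))"
    using \<theta> by (intro mult_right_mono) auto
  have e3: "48 * real n0 * real (card (N' - N)) \<le> c\<^sup>2 * real n"
  proof -
    have "48 * real n0 * real (card (N' - N)) \<le> c\<^sup>2 * real K * real (card (N' - N))"
      using K' by (intro mult_right_mono) auto
    also have "\<dots> \<le> c\<^sup>2 * real n" using diff csq by (simp add: mult.assoc mult.commute)
    finally show ?thesis .
  qed
  have e4: "\<epsilon> * real (card T) \<le> \<epsilon> * real n" using cT_n \<epsilon> by (intro mult_left_mono) auto
  have e5: "c * real (card N) \<le> \<theta> * real (card N)" using \<epsilon> by (intro mult_right_mono) (auto simp: \<theta>_def)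
  have e6: "c * (\<epsilon> * real n) \<le> \<epsilon> * real n" "c * real n0 \<le> real n0"
    using mult_right_mono[OF c1, of "\<epsilon> * real n"] mult_right_mono[OF c1, of "real n0"] \<epsilon> by auto
  have "c * real (card N) \<le> 2 * (\<epsilon> * real n) + 4 * real n0 + 2 * (real n0 * (2 * real g + real (card (N' - N))))"
    using up lo e2 e4 e5 by (simp add: \<theta>_def algebra_simps)
  moreover have "c\<^sup>2 * real n / 4 - \<epsilon> * real n - 4 * real n0 \<le> c * real (card N)"
    using e1 e6 by (simp add: algebra_simps power2_eq_square)
  moreover have "2 * (real n0 * (2 * real g + real (card (N' - N)))) \<le> c\<^sup>2 * real n / 48 + c\<^sup>2 * real n / 24"
    using n1 e3 by (simp add: algebra_simps)
  moreover have "0 < c\<^sup>2 * real n" using csq n by simp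
  ultimately show False using n2 unfolding \<epsilon>n by linarith
qed

section \<open>Counting progressions in dense sets\<close>

text \<open>
  Varnavides' argument: for each of the \<open>S\<close> steps \<open>s\<close> between \<open>S\<close> and \<open>2 * S\<close>, a positive proportion of
  the frames \<open>a, a + s, \<dots>, a + (L - 1) * s\<close> meets \<open>A\<close> in a set dense enough for Roth's theorem. The
  lower bound \<open>S\<close> on the difference keeps the progressions found away from the trivial ones.\<close>

lemma many_progressions_of_dense_set:
  fixes A :: "int set" and \<delta> :: real and L P S :: nat
  assumes L: "0 < L" and roth: "\<And>B. B \<subseteq> {0..<int L} \<Longrightarrow> \<delta> / 6 * real L \<le> real (card B) \<Longrightarrow> \<not> ap_free B"
    and \<delta>: "0 < \<delta>" and A: "A \<subseteq> {0..int P}" "\<delta> * real P \<le> real (card A)" 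
    and S: "0 < S" "2 * S * L \<le> P"
  shows "\<delta> * real S * real P / (2 * (real L)\<^sup>2) 
    \<le> real (card {(x, D). x \<in> A \<and> x + D \<in> A \<and> x + 2 * D \<in> A \<and> int S \<le> D \<and> D \<le> int (2 * S * L)})"
    (is "_ \<le> real (card ?X)")
proof -
  have finA: "finite A" using A(1) finite_subset by blast
  have P: "0 < P" using S L by (metis gr0I le_zero_eq mult_is_0 zero_neq_numeral less_irrefl)
  define \<Omega> where "\<Omega> = {- int P..int P}"
  define f where "f s a = {t \<in> {0..<int L}. a + s * t \<in> A}" for s a
  define good where "good s = {a \<in> \<Omega>. \<delta> / 6 * real L \<le> real (card (f s a))}" for s
  have fin: "finite \<Omega>" "finite (f s a)" "finite (good s)" for s a
    by (auto simp: \<Omega>_def f_def good_def intro: finite_subset[of _ "{0..<int L}"] finite_subset[of _ "{-int P..int P}"])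
  have card_good: "\<delta> * real P / 2 \<le> real (card (good s))" if s: "s \<in> {int S..<2 * int S}" for s
  proof -
    have "(\<Sum>a\<in>\<Omega>. card (f s a)) = card (SIGMA a:\<Omega>. f s a)"
      using fin by simp
    also have "\<dots> = card (A \<times> {0..<int L})"
    proof (rule bij_betw_same_card)
      show "bij_betw (\<lambda>(a, t). (a + s * t, t)) (SIGMA a:\<Omega>. f s a) (A \<times> {0..<int L})"
      proof (rule bij_betwI[where g = "\<lambda>(x, t). (x - s * t, t)"])
        show "(\<lambda>(x, t). (x - s * t, t)) \<in> A \<times> {0..<int L} \<rightarrow> (SIGMA a:\<Omega>. f s a)"
        proof (clarsimp simp: f_def)
          fix x t assume xt: "x \<in> A" "0 \<le> t" "t < int L"
          have "s * t \<le> (2 * int S) * int L" using s xt by (intro mult_mono) auto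
          also have "\<dots> \<le> int P" using S(2) by (metis of_nat_le_iff of_nat_mult of_nat_numeral)
          finally have "s * t \<le> int P" .
          moreover have "0 \<le> s * t" using s xt by auto
          moreover have "0 \<le> x" "x \<le> int P" using A(1) xt by auto
          ultimately show "x - s * t \<in> \<Omega>" by (auto simp: \<Omega>_def)
        qed
      qed (auto simp: f_def)
    qed
    also have "\<dots> = card A * L" by (simp add: card_cartesian_product)
    finally have "real (card A) * real L = (\<Sum>a\<in>\<Omega>. real (card (f s a)))"
      by (metis of_nat_mult of_nat_sum)
    also have "\<dots> \<le> (\<Sum>a\<in>\<Omega>. (if a \<in> good s then real L else 0) + \<delta> / 6 * real L)"
    proof (rule sum_mono)
      fix a assume a: "a \<in> \<Omega>"
      have "card (f s a) \<le> card {0..<int L}" by (intro card_mono) (auto simp: f_def)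
      hence "real (card (f s a)) \<le> real L" by simp
      moreover have "0 \<le> \<delta> / 6 * real L" using \<delta> by simp
      ultimately show "real (card (f s a)) \<le> (if a \<in> good s then real L else 0) + \<delta> / 6 * real L"
        using a by (auto simp: good_def)
    qed
    also have "\<dots> = real (card (good s)) * real L + real (card \<Omega>) * (\<delta> / 6 * real L)"
    proof -
      have "(\<Sum>a\<in>\<Omega>. (if a \<in> good s then real L else 0)) = (\<Sum>a\<in>good s. real L)"
        using fin by (intro sum.mono_neutral_cong_right) (auto simp: good_def)
      thus ?thesis by (simp add: sum.distrib)
    qed
    also have "real (card \<Omega>) * (\<delta> / 6 * real L) \<le> (3 * real P) * (\<delta> / 6 * real L)"
      using P \<delta> by (intro mult_right_mono) (auto simp: \<Omega>_def)
    finally have "real (card A) * real L \<le> (real (card (good s)) + \<delta> * real P / 2) * real L"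
      by (simp add: algebra_simps)
    hence "real (card A) \<le> real (card (good s)) + \<delta> * real P / 2" using L by simp
    thus ?thesis using A(2) by linarith
  qed
  define Q where "Q s a = (\<lambda>(t, e). t \<in> {0..<int L} \<and> e \<in> {0..<int L} \<and> 0 < e \<and> a + s * t \<in> A 
      \<and> a + s * (t + e) \<in> A \<and> a + s * (t + 2 * e) \<in> A)" for s a
  define t where "t s a = fst (SOME q. Q s a q)" for s a
  define e where "e s a = snd (SOME q. Q s a q)" for s a
  have Q: "Q s a (t s a, e s a)" if "a \<in> good s" for s a
  proof -
    have "\<not> ap_free (f s a)" using that by (intro roth) (auto simp: f_def good_def)
    then obtain t e where te: "0 < e" "t \<in> f s a" "t + e \<in> f s a" "t + 2 * e \<in> f s a" 
      unfolding ap_free_def by blast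
    hence "Q s a (t, e)" by (auto simp: f_def Q_def)
    thus ?thesis unfolding t_def e_def prod.collapse by (rule someI)
  qed
  have te: "\<And>s a. a \<in> good s \<Longrightarrow> t s a \<in> {0..<int L}" 
      "\<And>s a. a \<in> good s \<Longrightarrow> e s a \<in> {0..<int L}" "\<And>s a. a \<in> good s \<Longrightarrow> 0 < e s a"
      "\<And>s a. a \<in> good s \<Longrightarrow> a + s * t s a \<in> A" "\<And>s a. a \<in> good s \<Longrightarrow> a + s * (t s a + e s a) \<in> A"
      "\<And>s a. a \<in> good s \<Longrightarrow> a + s * (t s a + 2 * e s a) \<in> A"
    using Q by (simp_all add: Q_def)
  define W where "W = (SIGMA s:{int S..<2 * int S}. good s)"
  \<comment> \<open>A progression in \<open>A\<close> remembers the frame \<open>(s, a)\<close> it came from, up to its position inside that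
    frame; hence the loss of at most \<open>L\<^sup>2\<close>.\<close>
  define \<phi> where "\<phi> = (\<lambda>(s, a). ((a + s * t s a, s * e s a), (t s a, e s a)))"
  have "inj_on \<phi> W"
  proof (rule inj_onI)
    fix u v assume uv: "u \<in> W" "v \<in> W" "\<phi> u = \<phi> v"
    obtain s a s' a' where [simp]: "u = (s, a)" "v = (s', a')" by (cases u, cases v)
    have *: "a \<in> good s" "s * e s a = s' * e s' a'" "e s a = e s' a'"
       "a + s * t s a = a' + s' * t s' a'" "t s a = t s' a'"
      using uv by (auto simp: W_def \<phi>_def)
    have "e s a \<noteq> 0" using te(3)[OF *(1)] by simp
    hence "s = s'" using *(2,3) by simp
    thus "u = v" using *(4,5) by simp
  qed
  moreover have "\<phi> ` W \<subseteq> ?X \<times> ({0..<int L} \<times> {0..<int L})"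
  proof
    fix w assume "w \<in> \<phi> ` W"
    then obtain s a where w: "w = ((a + s * t s a, s * e s a), (t s a, e s a))"
      and s: "int S \<le> s" "s < 2 * int S" and a: "a \<in> good s" by (auto simp: W_def \<phi>_def)
    note te' = te[OF a]
    have "int S * 1 \<le> s * e s a" using s te' by (intro mult_mono) auto
    moreover have "s * e s a \<le> (2 * int S) * int L" using s te' by (intro mult_mono) auto
    ultimately show "w \<in> ?X \<times> ({0..<int L} \<times> {0..<int L})"
      unfolding w using te' by (simp add: algebra_simps)
  qed
  moreover have finX: "finite ?X"
    by (rule finite_subset[of _ "A \<times> {int S..int (2 * S * L)}"]) (use finA in auto)
  ultimately have "card W \<le> card (?X \<times> ({0..<int L} \<times> {0..<int L}))"
    by (intro card_inj_on_le) auto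
  hence "real (card W) \<le> real (card ?X * (L * L))"
    unfolding of_nat_le_iff by (simp add: card_cartesian_product)
  moreover have "real S * (\<delta> * real P / 2) \<le> real (card W)"
  proof -
    have "real S * (\<delta> * real P / 2) = (\<Sum>s\<in>{int S..<2 * int S}. \<delta> * real P / 2)" by simp
    also have "\<dots> \<le> (\<Sum>s\<in>{int S..<2 * int S}. real (card (good s)))" by (intro sum_mono card_good)
    also have "\<dots> = real (card W)" using fin by (simp add: W_def)
    finally show ?thesis .
  qed
  ultimately have "real S * (\<delta> * real P / 2) \<le> real (card ?X) * (real L * real L)" by simp
  thus ?thesis using L by (simp add: field_simps power2_eq_square)
qed

section \<open>The Fejer kernel\<close>

definition unit_exp :: "real \<Rightarrow> complex" where
  "unit_exp t = cis (2 * pi * t)"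

lemma unit_exp_add: "unit_exp (s + t) = unit_exp s * unit_exp t"
  by (simp add: unit_exp_def cis_mult algebra_simps)

lemma unit_exp_0 [simp]: "unit_exp 0 = 1"
  by (simp add: unit_exp_def)

lemma norm_unit_exp [simp]: "norm (unit_exp t) = 1"
  by (simp add: unit_exp_def)

lemma unit_exp_minus: "unit_exp (- t) = cnj (unit_exp t)"
  by (simp add: unit_exp_def cis_cnj)

lemma unit_exp_power: "unit_exp t ^ n = unit_exp (real n * t)"
  by (simp add: unit_exp_def Complex.DeMoivre algebra_simps)

lemma continuous_on_unit_exp [continuous_intros]:
  "continuous_on S f \<Longrightarrow> continuous_on S (\<lambda>x. unit_exp (f x))"
  unfolding unit_exp_def by (intro continuous_intros)

lemma unit_exp_measurable [measurable]: "unit_exp \<in> borel_measurable borel"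
  by (intro borel_measurable_continuous_onI continuous_intros)

lemma unit_exp_eq_1_iff: "unit_exp t = 1 \<longleftrightarrow> t \<in> \<int>"
proof
  assume "unit_exp t = 1"
  hence "exp (\<i> * of_real (2 * pi * t)) = 1" by (simp add: unit_exp_def cis_conv_exp)
  then obtain k :: int where "2 * pi * t = of_int (2 * k) * pi" 
    by (auto simp: exp_eq_1)
  hence "t = of_int k" by (simp add: field_simps)
  thus "t \<in> \<int>" by simp
qed (auto elim!: Ints_cases simp: unit_exp_def complex_eq_iff cos_int_2pin sin_int_2pin)

definition fejer :: "nat \<Rightarrow> real \<Rightarrow> real" where
  "fejer n t = (cmod (\<Sum>j<n. unit_exp (real j * t)))\<^sup>2 / real n"

definition fejer_coeff :: "nat \<Rightarrow> int \<Rightarrow> real" where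
  "fejer_coeff n k = max 0 (1 - \<bar>real_of_int k\<bar> / real n)"

lemma fejer_nonneg [simp]: "0 \<le> fejer n t"
  by (simp add: fejer_def)

lemma fejer_1: "fejer 1 t = 1"
  by (simp add: fejer_def)

lemma continuous_on_fejer [continuous_intros]:
  "continuous_on S f \<Longrightarrow> continuous_on S (\<lambda>x. fejer n (f x))"
  unfolding fejer_def divide_inverse by (intro continuous_intros)

text \<open>
  Wherever \<open>unit_exp t\<close> stays away from \<open>1\<close>, the kernel tends to \<open>0\<close> uniformly as \<open>n\<close> grows.\<close>

lemma fejer_le:
  assumes "unit_exp t \<noteq> 1"
  shows "fejer n t \<le> 4 / (real n * (cmod (unit_exp t - 1))\<^sup>2)"
proof (cases "n = 0")
  case False
  have "(\<Sum>j<n. unit_exp (real j * t)) = (\<Sum>j<n. unit_exp t ^ j)"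
    by (simp add: unit_exp_power)
  also have "\<dots> = (unit_exp t ^ n - 1) / (unit_exp t - 1)" by (rule geometric_sum) fact
  finally have "cmod (\<Sum>j<n. unit_exp (real j * t)) = cmod (unit_exp t ^ n - 1) / cmod (unit_exp t - 1)"
    by (simp add: norm_divide)
  also have "\<dots> \<le> 2 / cmod (unit_exp t - 1)"
    using norm_triangle_ineq4[of "unit_exp t ^ n" 1] by (intro divide_right_mono) (auto simp: norm_power)
  finally have "(cmod (\<Sum>j<n. unit_exp (real j * t)))\<^sup>2 \<le> (2 / cmod (unit_exp t - 1))\<^sup>2"
    by (intro power_mono) auto
  hence "fejer n t \<le> (2 / cmod (unit_exp t - 1))\<^sup>2 / real n"
    unfolding fejer_def by (intro divide_right_mono) auto
  thus ?thesis by (simp add: power_divide mult.commute)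
qed (simp add: fejer_def)

lemma fejer_ge:
  assumes "0 < n" "\<bar>t\<bar> \<le> 1 / (6 * real n)"
  shows "real n / 4 \<le> fejer n t"
proof -
  have "1 / 2 \<le> Re (unit_exp (real j * t))" if "j < n" for j
  proof -
    have "\<bar>real j * t\<bar> \<le> real n * (1 / (6 * real n))"
      unfolding abs_mult using that assms by (intro mult_mono) auto
    hence "\<bar>2 * pi * (real j * t)\<bar> \<le> pi / 3" using assms by (simp add: abs_mult field_simps)
    hence "cos (pi / 3) \<le> cos \<bar>2 * pi * (real j * t)\<bar>"
      by (intro cos_monotone_0_pi_le) auto
    thus ?thesis by (simp add: unit_exp_def cos_60 cos_abs_real)
  qed
  hence "(\<Sum>j<n. 1 / 2) \<le> (\<Sum>j<n. Re (unit_exp (real j * t)))" by (intro sum_mono) auto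
  also have "\<dots> \<le> cmod (\<Sum>j<n. unit_exp (real j * t))" by (metis Re_sum complex_Re_le_cmod)
  finally have "(real n / 2)\<^sup>2 \<le> (cmod (\<Sum>j<n. unit_exp (real j * t)))\<^sup>2" by (intro power_mono) auto
  thus ?thesis using assms by (simp add: fejer_def field_simps power2_eq_square)
qed

lemma sum_symmetric_int: 
  fixes f :: "int \<Rightarrow> 'a :: comm_monoid_add"
  shows "(\<Sum>k\<in>{-int (Suc n)..int (Suc n)}. f k) = (\<Sum>k\<in>{-int n..int n}. f k) + (f (int (Suc n)) + f (- int (Suc n)))"
proof -
  have "{-int (Suc n)..int (Suc n)} = insert (int (Suc n)) (insert (- int (Suc n)) {-int n..int n})"
    by auto
  thus ?thesis by (simp add: add_ac)
qed

lemma dirichlet_square: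
  "(\<Sum>k\<in>{-int n..int n}. of_real (max 0 (real n - \<bar>real_of_int k\<bar>)) * unit_exp (real_of_int k * t))
     = of_real ((cmod (\<Sum>j<n. unit_exp (real j * t)))\<^sup>2)"
proof (induction n)
  case (Suc n)
  let ?S = "\<Sum>j<n. unit_exp (real j * t)"
  let ?e = "\<lambda>k::int. unit_exp (real_of_int k * t)"
  have D: "(\<Sum>k\<in>{-int m..int m}. ?e k) = 1 + (\<Sum>j<m. ?e (int (Suc j)) + ?e (- int (Suc j)))" for m
    by (induction m) (simp_all add: sum_symmetric_int del: of_nat_Suc)
  have "(\<Sum>k\<in>{-int (Suc n)..int (Suc n)}. of_real (max 0 (real (Suc n) - \<bar>real_of_int k\<bar>)) * ?e k)
     = (\<Sum>k\<in>{-int n..int n}. of_real (max 0 (real (Suc n) - \<bar>real_of_int k\<bar>)) * ?e k)"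
    unfolding sum_symmetric_int by simp
  also have "\<dots> = (\<Sum>k\<in>{-int n..int n}. of_real (max 0 (real n - \<bar>real_of_int k\<bar>)) * ?e k + ?e k)"
  proof (rule sum.cong)
    fix k assume "k \<in> {-int n..int n}"
    hence "\<bar>k\<bar> \<le> int n" by auto
    hence "\<bar>real_of_int k\<bar> \<le> real n" by linarith
    thus "of_real (max 0 (real (Suc n) - \<bar>real_of_int k\<bar>)) * ?e k =
      of_real (max 0 (real n - \<bar>real_of_int k\<bar>)) * ?e k + ?e k"
      by (simp add: max_def algebra_simps)
  qed simp
  also have "\<dots> = of_real ((cmod ?S)\<^sup>2) + (1 + (\<Sum>j<n. ?e (int (Suc j)) + ?e (- int (Suc j))))"
    unfolding sum.distrib Suc.IH D ..
  also have "(\<Sum>j<n. ?e (int (Suc j)) + ?e (- int (Suc j))) = 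
     (\<Sum>j<n. unit_exp (real n * t) * cnj (unit_exp (real j * t)) + cnj (unit_exp (real n * t)) * unit_exp (real j * t))"
  proof -
    have "(\<Sum>j<n. unit_exp (real n * t) * cnj (unit_exp (real j * t)) + cnj (unit_exp (real n * t)) * unit_exp (real j * t))
      = (\<Sum>j<n. unit_exp (real (n - j) * t) + unit_exp (- real (n - j) * t))"
      by (intro sum.cong) (auto simp: unit_exp_minus[symmetric] unit_exp_add[symmetric] of_nat_diff algebra_simps)
    also have "\<dots> = (\<Sum>j<n. unit_exp (real (Suc j) * t) + unit_exp (- real (Suc j) * t))"
      by (subst sum.nat_diff_reindex[symmetric]) (intro sum.cong, auto simp: Suc_diff_Suc)
    finally show ?thesis by simp
  qed
  also have "\<dots> = unit_exp (real n * t) * cnj ?S + cnj (unit_exp (real n * t)) * ?S"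
    by (simp add: sum.distrib sum_distrib_left)
  also have "of_real ((cmod ?S)\<^sup>2) + (1 + \<dots>) = of_real ((cmod (?S + unit_exp (real n * t)))\<^sup>2)"
  proof -
    have "unit_exp (real n * t) * cnj (unit_exp (real n * t)) = 1"
      by (simp add: complex_norm_square[symmetric])
    thus ?thesis by (simp add: complex_norm_square algebra_simps del: of_real_power)
  qed
  finally show ?case by simp
qed simp

lemma fejer_expansion:
  assumes "0 < n" "n \<le> m"
  shows "of_real (fejer n t) = (\<Sum>k\<in>{-int m..int m}. of_real (fejer_coeff n k) * unit_exp (real_of_int k * t))"
proof -
  have coeff: "fejer_coeff n k = max 0 (real n - \<bar>real_of_int k\<bar>) / real n" for k
    using assms by (auto simp: fejer_coeff_def max_def field_simps)
  have "(\<Sum>k\<in>{-int m..int m}. of_real (fejer_coeff n k) * unit_exp (real_of_int k * t)) =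
    (\<Sum>k\<in>{-int n..int n}. of_real (fejer_coeff n k) * unit_exp (real_of_int k * t))"
  proof (rule sum.mono_neutral_right)
    show "\<forall>k\<in>{- int m..int m} - {- int n..int n}. of_real (fejer_coeff n k) * unit_exp (real_of_int k * t) = 0"
    proof
      fix k assume "k \<in> {- int m..int m} - {- int n..int n}"
      hence "int n \<le> \<bar>k\<bar>" by auto
      hence "real n \<le> \<bar>real_of_int k\<bar>" by linarith
      thus "of_real (fejer_coeff n k) * unit_exp (real_of_int k * t) = 0" by (simp add: coeff max_def)
    qed
  qed (use assms in auto)
  also have "\<dots> = (\<Sum>k\<in>{-int n..int n}. of_real (max 0 (real n - \<bar>real_of_int k\<bar>)) * unit_exp (real_of_int k * t)) / of_real (real n)"
    unfolding coeff by (simp add: sum_divide_distrib)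
  also have "\<dots> = of_real (fejer n t)"
    unfolding dirichlet_square fejer_def by simp
  finally show ?thesis ..
qed

text \<open>
  The difference is at most \<open>min 1 (\<bar>k\<bar> / N)\<close>; the interpolated form with exponent \<open>s\<close> is what the
  decay of the Fourier coefficients can absorb.\<close>

lemma fejer_coeff_diff_le:
  assumes "0 < N" "N \<le> n" "0 \<le> s" "s \<le> 1"
  shows "\<bar>fejer_coeff n k - fejer_coeff N k\<bar> \<le> (\<bar>real_of_int k\<bar> / real N) powr s"
proof -
  let ?x = "\<bar>real_of_int k\<bar> / real N"
  have "\<bar>real_of_int k\<bar> / real n \<le> ?x" using assms by (intro divide_left_mono) auto
  hence "\<bar>fejer_coeff n k - fejer_coeff N k\<bar> \<le> min 1 ?x"
    by (auto simp: fejer_coeff_def max_def min_def)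
  also have "\<dots> \<le> ?x powr s"
  proof (cases "?x \<le> 1")
    case True
    hence "?x powr 1 \<le> ?x powr s" using assms by (intro powr_mono') auto
    thus ?thesis using True by simp
  next
    case False
    hence "1 \<le> ?x powr s" using assms by (intro ge_one_powr_ge_zero) auto
    thus ?thesis by simp
  qed
  finally show ?thesis .
qed

lemma fejer_le_self: "fejer n t \<le> real n"
proof (cases "n = 0")
  case False
  have "cmod (\<Sum>j<n. unit_exp (real j * t)) \<le> (\<Sum>j<n. cmod (unit_exp (real j * t)))" by (rule norm_sum)
  hence "(cmod (\<Sum>j<n. unit_exp (real j * t)))\<^sup>2 \<le> (real n)\<^sup>2" by (intro power_mono) auto
  thus ?thesis using False by (simp add: fejer_def field_simps power2_eq_square)
qed (simp add: fejer_def)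

section \<open>Absolutely convex combinations of characters\<close>

text \<open>
  The absolutely convex hull of the characters of the torus: trigonometric polynomials whose
  coefficients have absolute sum at most \<open>1\<close>. An estimate for characters that is stable under absolutely
  convex combinations holds for these with the same constant, whatever their degree.\<close>

inductive trig_avg :: "(real \<Rightarrow> real \<Rightarrow> complex) \<Rightarrow> bool" where
  char: "trig_avg (\<lambda>x z. unit_exp (of_int j * x + of_int l * z))"
| comb: "trig_avg f \<Longrightarrow> trig_avg g \<Longrightarrow> norm s + norm t \<le> 1 \<Longrightarrow> trig_avg (\<lambda>x z. s * f x z + t * g x z)"

lemma trig_avg_1: "trig_avg (\<lambda>x z. 1)"
  using trig_avg.char[of 0 0] by simp

lemma trig_avg_mult_char:
  "trig_avg f \<Longrightarrow> trig_avg (\<lambda>x z. unit_exp (of_int j * x + of_int l * z) * f x z)"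
proof (induction rule: trig_avg.induct)
  case (char j' l')
  show ?case using trig_avg.char[of "j + j'" "l + l'"]
    by (simp add: unit_exp_add[symmetric] algebra_simps)
next
  case (comb f g s t)
  show ?case using trig_avg.comb[OF comb.IH comb.hyps(3)] by (simp add: algebra_simps)
qed

text \<open>
  The coefficients have absolute sum \<open>1\<close>, so multiplication by either function preserves \<open>trig_avg\<close>.\<close>

lemma cos_sin_squared_unit_exp:
  "complex_of_real ((cos (pi * u))\<^sup>2) = 1 / 2 + (unit_exp u + unit_exp (- u)) / 4"
  "complex_of_real ((sin (pi * u))\<^sup>2) = 1 / 2 - (unit_exp u + unit_exp (- u)) / 4"
proof -
  have *: "unit_exp u + unit_exp (- u) = complex_of_real (2 * cos (2 * (pi * u)))"
    by (simp add: unit_exp_def complex_eq_iff mult.assoc mult.left_commute)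
  show "complex_of_real ((cos (pi * u))\<^sup>2) = 1 / 2 + (unit_exp u + unit_exp (- u)) / 4"
    unfolding * cos_double_cos by (simp add: complex_eq_iff field_simps)
  show "complex_of_real ((sin (pi * u))\<^sup>2) = 1 / 2 - (unit_exp u + unit_exp (- u)) / 4"
    unfolding * cos_double_sin by (simp add: complex_eq_iff field_simps)
qed

lemma trig_avg_mult_half:
  assumes "trig_avg f" "norm s = 1 / 2"
  shows "trig_avg (\<lambda>x z. (1 / 2 + s * ((unit_exp (of_int j * x + of_int l * z) + unit_exp (- (of_int j * x + of_int l * z))) / 2)) * f x z)"
proof -
  have "trig_avg (\<lambda>x z. (1/2) * (unit_exp (of_int j * x + of_int l * z) * f x z) 
          + (1/2) * (unit_exp (of_int (-j) * x + of_int (-l) * z) * f x z))"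
    by (rule trig_avg.comb[OF trig_avg_mult_char[OF assms(1)] trig_avg_mult_char[OF assms(1)]]) simp
  from trig_avg.comb[OF assms(1) this, of "1/2" s]
  have "trig_avg (\<lambda>x z. (1/2) * f x z + s * ((1/2) * (unit_exp (of_int j * x + of_int l * z) * f x z) 
          + (1/2) * (unit_exp (of_int (-j) * x + of_int (-l) * z) * f x z)))"
    using assms(2) by simp
  thus ?thesis by (simp add: algebra_simps add_divide_distrib)
qed

lemma trig_avg_mult_cos_squared:
  assumes "trig_avg f"
  shows "trig_avg (\<lambda>x z. complex_of_real ((cos (pi * (of_int j * x + of_int l * z)))\<^sup>2) * f x z)"
  using trig_avg_mult_half[OF assms, of "1/2" j l] unfolding cos_sin_squared_unit_exp by simp

lemma trig_avg_mult_sin_squared: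
  assumes "trig_avg f"
  shows "trig_avg (\<lambda>x z. complex_of_real ((sin (pi * (of_int j * x + of_int l * z)))\<^sup>2) * f x z)"
  using trig_avg_mult_half[OF assms, of "-1/2" j l] unfolding cos_sin_squared_unit_exp by simp

lemma norm_trig_avg_le_1: "trig_avg f \<Longrightarrow> norm (f x z) \<le> 1"
proof (induction rule: trig_avg.induct)
  case (comb f g s t)
  have "norm (s * f x z + t * g x z) \<le> norm s * norm (f x z) + norm t * norm (g x z)"
    by (metis norm_mult norm_triangle_ineq)
  also have "\<dots> \<le> norm s * 1 + norm t * 1" using comb by (intro add_mono mult_left_mono) auto
  finally show ?case using comb by simp
qed simp

lemma continuous_on_trig_avg:
  "trig_avg f \<Longrightarrow> continuous_on S u \<Longrightarrow> continuous_on S v \<Longrightarrow> continuous_on S (\<lambda>p. f (u p) (v p))"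
  by (induction rule: trig_avg.induct) (auto intro!: continuous_intros)

section \<open>Comparison of scales by Fourier decay\<close>

definition triple :: "real measure \<Rightarrow> (real \<times> real \<times> real) measure" where
  "triple \<mu> = \<mu> \<Otimes>\<^sub>M (\<mu> \<Otimes>\<^sub>M \<mu>)"

lemma sets_triple:
  assumes "sets \<mu> = sets borel"
  shows "sets (triple \<mu>) = sets borel"
  unfolding triple_def using assms 
  by (metis borel_prod sets_pair_measure_cong)

lemma prob_space_triple:
  assumes "prob_space \<mu>"
  shows "prob_space (triple \<mu>)"
proof -
  interpret prob_space \<mu> by fact
  interpret p: pair_prob_space \<mu> \<mu> ..
  interpret q: pair_prob_space \<mu> "\<mu> \<Otimes>\<^sub>M \<mu>" ..
  show ?thesis unfolding triple_def by unfold_locales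
qed

lemma integrable_triple:
  fixes g :: "real \<times> real \<times> real \<Rightarrow> 'b :: {banach, second_countable_topology}"
  assumes "prob_space \<mu>" "sets \<mu> = sets borel" "continuous_on UNIV g" "\<And>p. norm (g p) \<le> B"
  shows "integrable (triple \<mu>) g"
proof -
  interpret prob_space "triple \<mu>" using prob_space_triple assms(1) .
  have "g \<in> borel_measurable borel" using assms(3) by (rule borel_measurable_continuous_onI)
  hence "g \<in> borel_measurable (triple \<mu>)" using measurable_cong_sets[OF sets_triple[OF assms(2)] refl] by blast
  thus ?thesis using assms(4) by (intro integrable_const_bound[of _ B]) auto
qed

definition exp_mean :: "real measure \<Rightarrow> int \<Rightarrow> complex" where
  "exp_mean \<mu> k = (LINT x|\<mu>. unit_exp (of_int k * x))"

lemma integral_triple_char: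
  assumes "prob_space \<mu>" "sets \<mu> = sets borel"
  shows "(LINT (x, y, z)|triple \<mu>. unit_exp (of_int p * x) * (unit_exp (of_int q * y) * unit_exp (of_int r * z))) =
    exp_mean \<mu> p * (exp_mean \<mu> q * exp_mean \<mu> r)"
proof -
  interpret prob_space \<mu> by fact
  interpret p: pair_prob_space \<mu> \<mu> ..
  interpret q: pair_prob_space \<mu> "\<mu> \<Otimes>\<^sub>M \<mu>" ..
  have [measurable_cong]: "sets \<mu> = sets borel" by fact
  have "integrable (triple \<mu>) (\<lambda>(x, y, z). unit_exp (of_int p * x) * (unit_exp (of_int q * y) * unit_exp (of_int r * z)))"
    using assms by (intro integrable_triple[of _ _ 1]) 
      (auto simp: split_beta norm_mult intro!: continuous_intros)
  hence "(LINT (x, y, z)|triple \<mu>. unit_exp (of_int p * x) * (unit_exp (of_int q * y) * unit_exp (of_int r * z)))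
     = (LINT x|\<mu>. LINT w|(\<mu> \<Otimes>\<^sub>M \<mu>). unit_exp (of_int p * x) * (unit_exp (of_int q * fst w) * unit_exp (of_int r * snd w)))"
    unfolding triple_def by (subst q.integral_fst'[symmetric]) (auto simp: split_beta)
  also have "\<dots> = exp_mean \<mu> p * (LINT w|(\<mu> \<Otimes>\<^sub>M \<mu>). unit_exp (of_int q * fst w) * unit_exp (of_int r * snd w))"
    by (simp add: exp_mean_def)
  also have "(LINT w|(\<mu> \<Otimes>\<^sub>M \<mu>). unit_exp (of_int q * fst w) * unit_exp (of_int r * snd w)) = 
      (LINT y|\<mu>. LINT z|\<mu>. unit_exp (of_int q * y) * unit_exp (of_int r * z))"
  proof -
    have "integrable (\<mu> \<Otimes>\<^sub>M \<mu>) (\<lambda>w. unit_exp (of_int q * fst w) * unit_exp (of_int r * snd w))"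
      by (intro p.P.integrable_const_bound[of _ 1]) (auto simp: norm_mult)
    thus ?thesis by (subst p.integral_fst'[symmetric]) auto
  qed
  also have "\<dots> = exp_mean \<mu> q * exp_mean \<mu> r"
    by (simp add: exp_mean_def)
  finally show ?thesis .
qed

lemma exp_mean_eq_fourier_coeff:
  assumes "prob_space \<mu>" "sets \<mu> = sets borel" "measure \<mu> {0..1} = 1"
  shows "exp_mean \<mu> k = fourier_coeff \<mu> (- k)"
proof -
  interpret prob_space \<mu> by fact
  have [measurable_cong]: "sets \<mu> = sets borel" by fact
  have ae: "AE x in \<mu>. x \<in> {0..1::real}" using assms(3) by (rule AE_prob_1)
  show ?thesis unfolding exp_mean_def fourier_coeff_def set_lebesgue_integral_def
  proof (rule integral_cong_AE)
    show "AE x in \<mu>. unit_exp (of_int k * x) = indicat_real {0..1} x *\<^sub>R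
       exp (- (2 * complex_of_real pi * \<i> * of_int (- k) * complex_of_real x))"
      using ae by eventually_elim (simp add: unit_exp_def cis_conv_exp mult_ac)
  qed measurable
qed

lemma exp_mean_decay:
  fixes C\<^sub>2 B b u \<beta> :: real
  assumes \<mu>: "prob_space \<mu>" "sets \<mu> = sets borel" "measure \<mu> {0..1} = 1"
    and C: "0 \<le> C\<^sub>2" "B \<le> b" "0 \<le> b" "1 \<le> u"
    and decay: "\<And>k::int. k \<noteq> 0 \<Longrightarrow> cmod (fourier_coeff \<mu> k) \<le> C\<^sub>2 * u powr B * real_of_int \<bar>k\<bar> powr (- \<beta> / 2)"
  shows "cmod (exp_mean \<mu> k) \<le> (1 + C\<^sub>2) * u powr b * max 1 \<bar>real_of_int k\<bar> powr (- \<beta> / 2)"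
proof (cases "k = 0")
  case True
  interpret prob_space \<mu> by fact
  have "1 * 1 \<le> (1 + C\<^sub>2) * u powr b" using C by (intro mult_mono ge_one_powr_ge_zero) auto
  thus ?thesis using True prob_space by (simp add: exp_mean_def)
next
  case False
  have "cmod (exp_mean \<mu> k) \<le> C\<^sub>2 * u powr B * real_of_int \<bar>- k\<bar> powr (- \<beta> / 2)"
    using decay[of "- k"] False by (simp add: exp_mean_eq_fourier_coeff[OF \<mu>])
  also have "\<dots> \<le> (1 + C\<^sub>2) * u powr b * real_of_int \<bar>- k\<bar> powr (- \<beta> / 2)"
    using C by (intro mult_right_mono mult_mono powr_mono) auto
  also have "real_of_int \<bar>- k\<bar> = max 1 \<bar>real_of_int k\<bar>" using False by (simp add: max_def)
  finally show ?thesis .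
qed

lemma sum_powr_int_bounded:
  fixes \<sigma> :: real
  assumes "1 < \<sigma>"
  shows "\<exists>Z\<ge>0. \<forall>F :: int set. finite F \<longrightarrow> (\<Sum>k\<in>F. max 1 \<bar>real_of_int k\<bar> powr (- \<sigma>)) \<le> Z"
proof (intro exI conjI allI impI)
  let ?g = "\<lambda>k::int. max 1 \<bar>real_of_int k\<bar> powr (- \<sigma>)"
  let ?h = "\<lambda>n. real (Suc n) powr (- \<sigma>)"
  have "summable (\<lambda>n. real n powr (- \<sigma>))" using assms by (simp add: summable_real_powr_iff)
  hence sm: "summable ?h" by (subst (asm) summable_Suc_iff[symmetric])
  show "0 \<le> 1 + 2 * suminf ?h" using suminf_nonneg[OF sm] by simp
  fix F :: "int set" assume F: "finite F"
  define n where "n = nat (\<Sum>k\<in>F. \<bar>k\<bar>)"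
  have sub: "F \<subseteq> {-int n..int n}"
  proof
    fix k assume "k \<in> F"
    hence "\<bar>k\<bar> \<le> (\<Sum>k\<in>F. \<bar>k\<bar>)" using F by (intro member_le_sum) auto
    thus "k \<in> {-int n..int n}" unfolding n_def by auto
  qed
  have "(\<Sum>k\<in>F. ?g k) \<le> (\<Sum>k\<in>{-int n..int n}. ?g k)"
    using sub by (intro sum_mono2) auto
  also have "\<dots> = 1 + 2 * (\<Sum>j<n. ?h j)"
    by (induction n) (simp_all add: sum_symmetric_int algebra_simps max_def del: of_nat_Suc)
  also have "\<dots> \<le> 1 + 2 * suminf ?h"
    using sum_le_suminf[OF sm, of "{..<n}"] by simp
  finally show "(\<Sum>k\<in>F. ?g k) \<le> 1 + 2 * suminf ?h" .
qed

lemma am_gm_cubes: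
  fixes x y z :: real
  assumes "0 \<le> x" "0 \<le> y" "0 \<le> z"
  shows "x * y * z \<le> (x ^ 3 + y ^ 3 + z ^ 3) / 3"
proof -
  have "x ^ 3 + y ^ 3 + z ^ 3 - 3 * x * y * z = (x + y + z) * ((x - y)\<^sup>2 + (y - z)\<^sup>2 + (z - x)\<^sup>2) / 2"
    by (simp add: power2_eq_square power3_eq_cube algebra_simps)
  also have "\<dots> \<ge> 0" using assms by simp
  finally show ?thesis by simp
qed

text \<open>
  The arithmetic-geometric mean inequality separates the three factors, and each of the resulting sums runs
  over distinct integers.\<close>

lemma trilinear_sum_le:
  fixes b :: "int \<Rightarrow> real"
  assumes b: "\<And>k. 0 \<le> b k" and Z: "\<And>F. finite F \<Longrightarrow> (\<Sum>k\<in>F. b k ^ 3) \<le> Z" and F: "finite F"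
  shows "(\<Sum>k\<in>F. b (k + j) * b k * b (l - 2 * k)) \<le> Z"
proof -
  have inj: "(\<Sum>k\<in>F. b (f k) ^ 3) \<le> Z" if "inj_on f F" for f
    using Z[of "f ` F"] F that by (simp add: sum.reindex)
  have "(\<Sum>k\<in>F. b (k + j) * b k * b (l - 2 * k)) 
     \<le> (\<Sum>k\<in>F. (b (k + j) ^ 3 + b k ^ 3 + b (l - 2 * k) ^ 3) / 3)"
    using b by (intro sum_mono am_gm_cubes)
  also have "\<dots> = ((\<Sum>k\<in>F. b (k + j) ^ 3) + (\<Sum>k\<in>F. b k ^ 3) + (\<Sum>k\<in>F. b (l - 2 * k) ^ 3)) / 3"
    by (simp add: sum_divide_distrib[symmetric] sum.distrib)
  also have "\<dots> \<le> (Z + Z + Z) / 3"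
    by (intro divide_right_mono add_mono inj) (auto simp: inj_on_def intro: inj)
  finally show ?thesis by simp
qed

text \<open>
  The integral of \<open>unit_exp (k * (x + y - 2 * z) + j * x + l * z)\<close> is the product of the Fourier
  coefficients at \<open>k + j\<close>, \<open>k\<close> and \<open>l - 2 * k\<close>. The bound does not depend on \<open>j\<close> and \<open>l\<close>.\<close>

lemma fejer_trilinear_difference_char:
  fixes A \<beta> Z :: real
  defines "s \<equiv> (3 * \<beta> / 2 - 1) / 6" and "\<sigma> \<equiv> (3 * \<beta> / 2 + 1) / 2"
  assumes \<mu>: "prob_space \<mu>" "sets \<mu> = sets borel" and \<beta>: "2 / 3 < \<beta>" "\<beta> \<le> 1"
    and decay: "\<And>k. cmod (exp_mean \<mu> k) \<le> A * max 1 \<bar>real_of_int k\<bar> powr (- \<beta> / 2)"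
    and A: "0 \<le> A" and Z: "\<And>F :: int set. finite F \<Longrightarrow> (\<Sum>k\<in>F. max 1 \<bar>real_of_int k\<bar> powr (- \<sigma>)) \<le> Z"
    and N: "0 < N" "N \<le> n"
  shows "cmod (LINT (x, y, z)|triple \<mu>. of_real (fejer n (x + y - 2 * z) - fejer N (x + y - 2 * z)) 
      * unit_exp (of_int j * x + of_int l * z)) \<le> A ^ 3 * Z * real N powr (- s)"
proof -
  define d where "d k = fejer_coeff n k - fejer_coeff N k" for k
  define b where "b k = max 1 \<bar>real_of_int k\<bar> powr (- (\<beta> / 2 - s))" for k
  define K where "K = {- int n..int n}"
  have s: "0 < s" "s \<le> 1" using \<beta> by (auto simp: s_def)
  have expand: "of_real (fejer n (x + y - 2 * z) - fejer N (x + y - 2 * z)) * unit_exp (of_int j * x + of_int l * z)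
     = (\<Sum>k\<in>K. of_real (d k) * (unit_exp (of_int (k + j) * x) * (unit_exp (of_int k * y) * unit_exp (of_int (l - 2 * k) * z))))"
    for x y z
  proof -
    have "complex_of_real (fejer n (x + y - 2 * z) - fejer N (x + y - 2 * z)) =
       (\<Sum>k\<in>K. of_real (d k) * unit_exp (real_of_int k * (x + y - 2 * z)))"
      using N fejer_expansion[of n n "x + y - 2 * z"] fejer_expansion[of N n "x + y - 2 * z"]
      by (simp add: K_def d_def sum_subtractf algebra_simps)
    thus ?thesis
      by (simp only: sum_distrib_right) (simp add: unit_exp_add[symmetric] mult.assoc algebra_simps)
  qed
  have int: "integrable (triple \<mu>) (\<lambda>(x, y, z). of_real (d k) * (unit_exp (of_int (k + j) * x) * (unit_exp (of_int k * y) * unit_exp (of_int (l - 2 * k) * z))))" for k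
    using \<mu> by (intro integrable_triple[of _ _ "\<bar>d k\<bar>"]) 
      (auto simp: split_beta norm_mult intro!: continuous_intros)
  have "(LINT (x, y, z)|triple \<mu>. of_real (fejer n (x + y - 2 * z) - fejer N (x + y - 2 * z)) * unit_exp (of_int j * x + of_int l * z))
     = (\<Sum>k\<in>K. of_real (d k) * (LINT (x, y, z)|triple \<mu>. unit_exp (of_int (k + j) * x) * (unit_exp (of_int k * y) * unit_exp (of_int (l - 2 * k) * z))))"
    unfolding expand split_beta using int[unfolded split_beta]
    by (subst Bochner_Integration.integral_sum) auto
  also have "\<dots> = (\<Sum>k\<in>K. of_real (d k) * (exp_mean \<mu> (k + j) * (exp_mean \<mu> k * exp_mean \<mu> (l - 2 * k))))"
    by (simp only: integral_triple_char[OF \<mu>])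
  also have "cmod \<dots> \<le> (\<Sum>k\<in>K. A ^ 3 * real N powr (- s) * (b (k + j) * b k * b (l - 2 * k)))"
  proof (rule sum_norm_le)
    fix k assume "k \<in> K"
    have le_b: "cmod (exp_mean \<mu> i) \<le> A * b i" for i
    proof -
      have "max 1 \<bar>real_of_int i\<bar> powr (- \<beta> / 2) \<le> b i"
        unfolding b_def using s by (intro powr_mono) auto
      thus ?thesis using decay[of i] A by (meson mult_left_mono order_trans)
    qed
    \<comment> \<open>Part of the decay of the middle factor is traded for a power of \<open>N\<close>; the remaining
      exponents still add up to \<open>\<sigma> > 1\<close>.\<close>
    have "\<bar>d k\<bar> * cmod (exp_mean \<mu> k) \<le> (max 1 \<bar>real_of_int k\<bar> / real N) powr s * (A * max 1 \<bar>real_of_int k\<bar> powr (- \<beta> / 2))"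
    proof (intro mult_mono decay)
      have "\<bar>d k\<bar> \<le> (\<bar>real_of_int k\<bar> / real N) powr s"
        unfolding d_def using N s by (intro fejer_coeff_diff_le) auto
      also have "\<dots> \<le> (max 1 \<bar>real_of_int k\<bar> / real N) powr s"
        using s N by (intro powr_mono2 divide_right_mono) auto
      finally show "\<bar>d k\<bar> \<le> (max 1 \<bar>real_of_int k\<bar> / real N) powr s" .
    qed auto
    also have "\<dots> = A * real N powr (- s) * b k"
      by (simp add: b_def powr_divide powr_minus_divide powr_diff powr_add)
    finally have dk: "\<bar>d k\<bar> * cmod (exp_mean \<mu> k) \<le> A * real N powr (- s) * b k" .
    have "cmod (of_real (d k) * (exp_mean \<mu> (k + j) * (exp_mean \<mu> k * exp_mean \<mu> (l - 2 * k))))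
       = (\<bar>d k\<bar> * cmod (exp_mean \<mu> k)) * (cmod (exp_mean \<mu> (k + j)) * cmod (exp_mean \<mu> (l - 2 * k)))"
      by (simp add: norm_mult)
    also have "\<dots> \<le> (A * real N powr (- s) * b k) * ((A * b (k + j)) * (A * b (l - 2 * k)))"
      using A by (intro mult_mono dk le_b) (auto simp: b_def)
    also have "\<dots> = A ^ 3 * real N powr (- s) * (b (k + j) * b k * b (l - 2 * k))"
      by (simp add: power3_eq_cube mult_ac)
    finally show "cmod (of_real (d k) * (exp_mean \<mu> (k + j) * (exp_mean \<mu> k * exp_mean \<mu> (l - 2 * k)))) 
        \<le> A ^ 3 * real N powr (- s) * (b (k + j) * b k * b (l - 2 * k))" .
  qed
  also have "\<dots> = A ^ 3 * real N powr (- s) * (\<Sum>k\<in>K. b (k + j) * b k * b (l - 2 * k))"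
    by (simp add: sum_distrib_left)
  also have "\<dots> \<le> A ^ 3 * real N powr (- s) * Z"
  proof (intro mult_left_mono trilinear_sum_le)
    fix F :: "int set" assume "finite F"
    have "b k ^ 3 = max 1 \<bar>real_of_int k\<bar> powr (- \<sigma>)" for k
    proof -
      have "b k ^ 3 = max 1 \<bar>real_of_int k\<bar> powr (3 * - (\<beta> / 2 - s))"
        unfolding b_def by (subst powr_power) (auto simp: mult.commute)
      also have "3 * - (\<beta> / 2 - s) = - \<sigma>" by (simp add: s_def \<sigma>_def field_simps)
      finally show ?thesis .
    qed
    thus "(\<Sum>k\<in>F. b k ^ 3) \<le> Z" using Z[OF \<open>finite F\<close>] by simp
  qed (use A in \<open>auto simp: b_def K_def\<close>)
  finally show ?thesis by (simp add: mult_ac)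
qed

lemma fejer_trilinear_difference:
  fixes A \<beta> Z :: real
  defines "s \<equiv> (3 * \<beta> / 2 - 1) / 6" and "\<sigma> \<equiv> (3 * \<beta> / 2 + 1) / 2"
  assumes \<mu>: "prob_space \<mu>" "sets \<mu> = sets borel" and \<beta>: "2 / 3 < \<beta>" "\<beta> \<le> 1"
    and decay: "\<And>k. cmod (exp_mean \<mu> k) \<le> A * max 1 \<bar>real_of_int k\<bar> powr (- \<beta> / 2)"
    and A: "0 \<le> A" and Z: "\<And>F :: int set. finite F \<Longrightarrow> (\<Sum>k\<in>F. max 1 \<bar>real_of_int k\<bar> powr (- \<sigma>)) \<le> Z"
    and N: "0 < N" "N \<le> n" and f: "trig_avg f"
  shows "cmod (LINT (x, y, z)|triple \<mu>. of_real (fejer n (x + y - 2 * z) - fejer N (x + y - 2 * z)) 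
      * f x z) \<le> A ^ 3 * Z * real N powr (- s)"
  using f
proof (induction rule: trig_avg.induct)
  case (char j l)
  show ?case using fejer_trilinear_difference_char[OF \<mu> \<beta> decay A _ N] Z
    by (simp add: s_def \<sigma>_def)
next
  case (comb f g s' t')
  define D where "D t = complex_of_real (fejer n t - fejer N t)" for t
  have D: "cmod (D t) \<le> real n + real N" for t
    unfolding D_def norm_of_real using fejer_le_self[of n t] fejer_le_self[of N t] 
      fejer_nonneg[of n t] fejer_nonneg[of N t] by linarith
  have int: "integrable (triple \<mu>) (\<lambda>(x, y, z). D (x + y - 2 * z) * h x z)" if "trig_avg h" for h
  proof (rule integrable_triple[OF \<mu>])
    show "continuous_on UNIV (\<lambda>(x, y, z). D (x + y - 2 * z) * h x z)"
      unfolding split_beta D_def using that by (intro continuous_intros continuous_on_trig_avg)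
    show "cmod (case p of (x, y, z) \<Rightarrow> D (x + y - 2 * z) * h x z) \<le> (real n + real N) * 1" for p
      unfolding split_beta norm_mult using that D by (intro mult_mono norm_trig_avg_le_1) auto
  qed
  let ?E = "A ^ 3 * Z * real N powr (- s)"
  have "(LINT (x, y, z)|triple \<mu>. D (x + y - 2 * z) * (s' * f x z + t' * g x z)) =
     (LINT (x, y, z)|triple \<mu>. s' * (D (x + y - 2 * z) * f x z) + t' * (D (x + y - 2 * z) * g x z))"
    by (simp add: algebra_simps)
  also have "\<dots> = s' * (LINT (x, y, z)|triple \<mu>. D (x + y - 2 * z) * f x z) 
       + t' * (LINT (x, y, z)|triple \<mu>. D (x + y - 2 * z) * g x z)"
    using int[OF comb.hyps(1)] int[OF comb.hyps(2)] unfolding split_beta by simp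
  also have "cmod \<dots> \<le> cmod s' * ?E + cmod t' * ?E"
    using comb.IH unfolding D_def[symmetric]
    by (intro norm_triangle_le add_mono) (auto simp: norm_mult intro!: mult_left_mono)
  also have "\<dots> = (cmod s' + cmod t') * ?E" by (simp add: algebra_simps)
  also have "\<dots> \<le> 1 * ?E"
    using comb.hyps(3) Z[of "{}"] A by (intro mult_right_mono) auto
  finally show ?case unfolding D_def by simp
qed

lemma integrable_fejer_mult:
  assumes \<mu>: "prob_space \<mu>" "sets \<mu> = sets borel" and f: "trig_avg (\<lambda>x z. complex_of_real (f x z))"
  shows "integrable (triple \<mu>) (\<lambda>(x, y, z). fejer n (x + y - 2 * z) * f x z)"
proof (rule integrable_triple[OF \<mu>])
  show "norm (case p of (x, y, z) \<Rightarrow> fejer n (x + y - 2 * z) * f x z) \<le> real n * 1" for p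
    unfolding split_beta norm_mult using norm_trig_avg_le_1[OF f]
    by (intro mult_mono) (auto simp: fejer_le_self)
  have "continuous_on UNIV (\<lambda>p. Re (complex_of_real (f (fst p) (snd (snd p)))))"
    by (intro continuous_intros continuous_on_trig_avg[OF f])
  hence "continuous_on UNIV (\<lambda>p. f (fst p) (snd (snd p)))" by simp
  thus "continuous_on UNIV (\<lambda>(x, y, z). fejer n (x + y - 2 * z) * f x z)"
    unfolding split_beta by (intro continuous_intros)
qed

lemma fejer_mass_difference:
  fixes A \<beta> Z :: real
  defines "s \<equiv> (3 * \<beta> / 2 - 1) / 6" and "\<sigma> \<equiv> (3 * \<beta> / 2 + 1) / 2"
  assumes \<mu>: "prob_space \<mu>" "sets \<mu> = sets borel" and \<beta>: "2 / 3 < \<beta>" "\<beta> \<le> 1"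
    and decay: "\<And>k. cmod (exp_mean \<mu> k) \<le> A * max 1 \<bar>real_of_int k\<bar> powr (- \<beta> / 2)"
    and A: "0 \<le> A" and Z: "\<And>F :: int set. finite F \<Longrightarrow> (\<Sum>k\<in>F. max 1 \<bar>real_of_int k\<bar> powr (- \<sigma>)) \<le> Z"
    and N: "0 < N" "N \<le> n" and f: "trig_avg (\<lambda>x z. complex_of_real (f x z))"
  shows "\<bar>(LINT (x, y, z)|triple \<mu>. fejer n (x + y - 2 * z) * f x z) 
     - (LINT (x, y, z)|triple \<mu>. fejer N (x + y - 2 * z) * f x z)\<bar> \<le> A ^ 3 * Z * real N powr (- s)"
proof -
  note int = integrable_fejer_mult[OF \<mu> f, unfolded split_beta]
  have "cmod (LINT p|triple \<mu>. complex_of_real (fejer n (fst p + fst (snd p) - 2 * snd (snd p)) * f (fst p) (snd (snd p))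
           - fejer N (fst p + fst (snd p) - 2 * snd (snd p)) * f (fst p) (snd (snd p))))
      \<le> A ^ 3 * Z * real N powr (- s)"
    using fejer_trilinear_difference[OF \<mu> \<beta> decay A _ N f] Z
    by (simp add: s_def \<sigma>_def split_beta' algebra_simps)
  thus ?thesis
    using int[of n] int[of N] unfolding integral_complex_of_real norm_of_real split_beta by simp
qed

section \<open>The weight on progressions\<close>

text \<open>
  A weight that is a trigonometric polynomial, so that the Fourier estimate applies to it. The first factor localizes
  \<open>x - z\<close> to the scale \<open>m powr (- 1 / 2)\<close>, the second removes trivial progressions, and the third, together
  with the first, suppresses triples that wrap around the circle.\<close>

definition ap_weight :: "nat \<Rightarrow> real \<Rightarrow> real \<Rightarrow> real" where
  "ap_weight m x z = ((cos (pi * (x - z)))\<^sup>2) ^ m * ((sin (pi * (x - z)))\<^sup>2 * (sin (pi * z))\<^sup>2)"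

lemma ap_weight_nonneg: "0 \<le> ap_weight m x z"
  by (simp add: ap_weight_def)

lemma continuous_on_ap_weight [continuous_intros]:
  fixes f g :: "'a :: t2_space \<Rightarrow> real"
  shows "continuous_on S f \<Longrightarrow> continuous_on S g \<Longrightarrow> continuous_on S (\<lambda>p. ap_weight m (f p) (g p))"
  unfolding ap_weight_def by (intro continuous_intros)

lemma trig_avg_ap_weight: "trig_avg (\<lambda>x z. complex_of_real (ap_weight m x z))"
proof -
  have "trig_avg (\<lambda>x z. complex_of_real (((cos (pi * (x - z)))\<^sup>2) ^ m * ((sin (pi * (x - z)))\<^sup>2 * (sin (pi * z))\<^sup>2)))"
  proof (induction m)
    case 0
    show ?case
      using trig_avg_mult_sin_squared[OF trig_avg_mult_sin_squared[OF trig_avg_1, of 0 1], of 1 "-1"]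
      by simp
  next
    case (Suc m)
    show ?case
      using trig_avg_mult_cos_squared[OF Suc.IH, of 1 "-1"] by (simp add: mult.assoc)
  qed
  thus ?thesis unfolding ap_weight_def .
qed

lemma ap_weight_le_1: "ap_weight m x z \<le> 1"
  using norm_trig_avg_le_1[OF trig_avg_ap_weight, of m x z] ap_weight_nonneg[of m x z] by simp

text \<open>
  By the mean value theorem, as \<open>cos\<close> is at least \<open>1 / 2\<close> up to \<open>pi / 3\<close>.\<close>

lemma sin_pi_ge_self:
  assumes "0 \<le> t" "t \<le> 1 / 3"
  shows "t \<le> sin (pi * t)"
proof (cases "t = 0")
  case False
  hence t: "0 < t" using assms by simp
  hence "\<exists>\<xi>. 0 < \<xi> \<and> \<xi> < pi * t \<and> sin (pi * t) - sin 0 = (pi * t - 0) * cos \<xi>"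
    by (intro MVT2) (auto intro!: derivative_eq_intros)
  then obtain \<xi> where \<xi>: "0 < \<xi>" "\<xi> < pi * t" "sin (pi * t) = pi * t * cos \<xi>" by auto
  have "pi * t \<le> pi * (1 / 3)" using assms by (intro mult_left_mono) auto
  hence "\<xi> \<le> pi / 3" using \<xi>(2) by linarith
  hence "cos (pi / 3) \<le> cos \<xi>" using \<xi> by (intro cos_monotone_0_pi_le) auto
  hence "pi * t * (1 / 2) \<le> pi * t * cos \<xi>" using t by (intro mult_left_mono) (auto simp: cos_60)
  moreover have "2 * t \<le> pi * t" using t pi_gt3 by (intro mult_right_mono) auto
  ultimately show ?thesis using \<xi>(3) by linarith
qed simp

lemma sin_squared_pi_ge:
  assumes "0 \<le> \<eta>" "\<eta> \<le> 1 / 3" "\<eta> \<le> z" "z \<le> 1 - \<eta>"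
  shows "\<eta>\<^sup>2 \<le> (sin (pi * z))\<^sup>2"
proof -
  have *: "\<eta> \<le> sin (pi * w)" if "\<eta> \<le> w" "w \<le> 1 / 2" for w
  proof -
    have "\<eta> \<le> sin (pi * \<eta>)" using assms by (intro sin_pi_ge_self)
    also have "pi * \<eta> \<le> pi * w" "pi * w \<le> pi * (1 / 2)" using that by (intro mult_left_mono; simp)+
    hence "sin (pi * \<eta>) \<le> sin (pi * w)"
      using assms(1) by (intro sin_monotone_2pi_le) (auto intro: order_trans[of _ 0])
    finally show ?thesis .
  qed
  have "\<eta> \<le> sin (pi * z)"
  proof (cases "z \<le> 1 / 2")
    case False
    hence "\<eta> \<le> sin (pi * (1 - z))" using assms by (intro *) auto
    thus ?thesis by (simp add: right_diff_distrib sin_pi_minus)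
  qed (use assms * in auto)
  thus ?thesis using assms by (intro power_mono)
qed

text \<open>
  With \<open>m = q\<^sup>2\<close>, Bernoulli's inequality keeps the localizing factor above \<open>1 / 2\<close> as long as
  \<open>\<bar>x - z\<bar>\<close> is at most a small multiple of \<open>1 / q\<close>.\<close>

lemma ap_weight_ge:
  assumes q: "0 < q" and d: "\<bar>x - z\<bar> \<le> 1 / (10 * real q)" and \<eta>: "0 \<le> \<eta>" "\<eta> \<le> 1 / 3" "\<eta> \<le> z" "z \<le> 1 - \<eta>"
  shows "(x - z)\<^sup>2 * \<eta>\<^sup>2 / 2 \<le> ap_weight (q\<^sup>2) x z"
proof -
  let ?d = "\<bar>x - z\<bar>"
  have "1 / (10 * real q) \<le> 1 / 10" using q by (simp add: field_simps)
  hence d13: "?d \<le> 1 / 3" using d by linarith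
  have sin_abs: "(sin (pi * (x - z)))\<^sup>2 = (sin (pi * ?d))\<^sup>2"
    by (cases "x \<ge> z") (simp_all add: abs_if minus_diff_eq[symmetric, of z x] del: minus_diff_eq)
  have "?d \<le> sin (pi * ?d)" using d13 by (intro sin_pi_ge_self) auto
  hence "?d\<^sup>2 \<le> (sin (pi * ?d))\<^sup>2" by (intro power_mono) auto
  hence sin: "(x - z)\<^sup>2 \<le> (sin (pi * (x - z)))\<^sup>2" by (simp add: sin_abs)
  have "(sin (pi * (x - z)))\<^sup>2 \<le> (pi * (x - z))\<^sup>2"
    using abs_sin_x_le_abs_x[of "pi * (x - z)"] by (rule abs_le_square_iff[THEN iffD1])
  also have "\<dots> = (pi * ?d)\<^sup>2" by (simp add: power_mult_distrib)
  also have "\<dots> \<le> (4 * (1 / (10 * real q)))\<^sup>2"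
    using d pi_less_4 by (intro power_mono mult_mono) auto
  finally have sq: "(sin (pi * (x - z)))\<^sup>2 \<le> 16 / (100 * (real q)\<^sup>2)" by (simp add: power_divide power_mult_distrib)
  have "1 / 2 \<le> 1 + real (q\<^sup>2) * (- (16 / (100 * (real q)\<^sup>2)))" using q by simp
  also have "\<dots> \<le> 1 + real (q\<^sup>2) * (- (sin (pi * (x - z)))\<^sup>2)"
    using sq by (intro add_left_mono mult_left_mono) auto
  also have "\<dots> \<le> (1 + (- (sin (pi * (x - z)))\<^sup>2)) ^ (q\<^sup>2)"
    by (rule Bernoulli_inequality) (simp add: abs_square_le_1)
  also have "1 + (- (sin (pi * (x - z)))\<^sup>2) = (cos (pi * (x - z)))\<^sup>2" by (simp add: cos_squared_eq)
  finally have cos: "1 / 2 \<le> ((cos (pi * (x - z)))\<^sup>2) ^ (q\<^sup>2)" .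
  have "1 / 2 * ((x - z)\<^sup>2 * \<eta>\<^sup>2) \<le> ap_weight (q\<^sup>2) x z"
    unfolding ap_weight_def using sin sin_squared_pi_ge[OF \<eta>] cos by (intro mult_mono) auto
  thus ?thesis by simp
qed

lemma sq_mult_power_le:
  fixes t :: real
  assumes "0 \<le> t" "t \<le> 1" "0 < m"
  shows "t\<^sup>2 * (1 - t) ^ m \<le> 2 / (real m)\<^sup>2"
proof -
  have "(1 - t) ^ m \<le> exp (- t) ^ m"
    using assms exp_ge_add_one_self[of "- t"] by (intro power_mono) auto
  also have "\<dots> = exp (- (real m * t))" by (simp add: exp_of_nat_mult[symmetric])
  finally have "t\<^sup>2 * (1 - t) ^ m \<le> t\<^sup>2 * exp (- (real m * t))" by (intro mult_left_mono) auto
  moreover have "(real m * t)\<^sup>2 / 2 \<le> exp (real m * t)"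
    using exp_lower_Taylor_quadratic[of "real m * t"] assms by (smt (verit) mult_nonneg_nonneg of_nat_0_le_iff)
  hence "t\<^sup>2 * exp (- (real m * t)) \<le> 2 / (real m)\<^sup>2"
    using assms by (simp add: exp_minus field_simps)
  ultimately show ?thesis by linarith
qed

text \<open>
  Here \<open>y\<close> is the reflection of \<open>x\<close> in \<open>z\<close> up to a non-zero integer. As that reflection leaves the unit
  interval, \<open>x\<close> is at least as far from \<open>z\<close> as the end that is passed, and as \<open>x\<close> stays inside, the distance is at
  most that of the other end.\<close>

lemma sin_le_abs_sin_of_wraparound:
  assumes "x \<in> {0..1}" "y \<in> {0..1}" "z \<in> {0..1}" "x + y - 2 * z \<in> \<int>" "x + y - 2 * z \<noteq> 0"
  shows "(sin (pi * z))\<^sup>2 \<le> (sin (pi * (x - z)))\<^sup>2"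
proof -
  obtain j :: int where j: "x + y - 2 * z = of_int j" using assms(4) by (elim Ints_cases)
  have j0: "j \<le> -1 \<or> 1 \<le> j" using j assms(5) by (cases "j = 0") auto
  have mono: "(sin (pi * s))\<^sup>2 \<le> (sin (pi * d))\<^sup>2" if "0 \<le> s" "s \<le> d" "d \<le> 1 - s" for s d :: real
  proof -
    have sd: "sin (pi * s) \<le> sin (pi * w)" if "s \<le> w" "w \<le> 1 / 2" for w
    proof -
      have "pi * s \<le> pi * w" "pi * w \<le> pi * (1 / 2)" "0 \<le> pi * s"
        using that \<open>0 \<le> s\<close> by (auto intro!: mult_left_mono)
      moreover have "- (pi / 2) \<le> pi * s" using \<open>0 \<le> pi * s\<close> pi_gt_zero by linarith
      ultimately show ?thesis by (intro sin_monotone_2pi_le) auto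
    qed
    have "sin (pi * s) \<le> sin (pi * d)"
    proof (cases "d \<le> 1 / 2")
      case False
      hence "sin (pi * s) \<le> sin (pi * (1 - d))" using that by (intro sd) auto
      thus ?thesis by (simp add: right_diff_distrib)
    qed (use that sd in auto)
    moreover have "0 \<le> sin (pi * s)"
      using that by (intro sin_ge_zero) (auto simp: mult_left_le)
    ultimately show ?thesis by (intro power_mono)
  qed
  from j0 show ?thesis
  proof
    assume "1 \<le> j"
    hence "z \<le> x - z" using j assms(2) by auto
    moreover have "x - z \<le> 1 - z" "0 \<le> z" using assms by auto
    ultimately show ?thesis by (intro mono)
  next
    assume "j \<le> -1"
    hence "x + y - 2 * z \<le> -1" using j by linarith
    hence "1 - z \<le> z - x" using assms(2) by auto
    moreover have "z - x \<le> 1 - (1 - z)" "0 \<le> 1 - z" using assms by auto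
    ultimately have "(sin (pi * (1 - z)))\<^sup>2 \<le> (sin (pi * (z - x)))\<^sup>2" by (intro mono)
    moreover have "sin (pi * (z - x)) = - sin (pi * (x - z))"
      by (simp add: sin_minus[symmetric] algebra_simps del: sin_minus)
    moreover have "sin (pi * (1 - z)) = sin (pi * z)" by (simp add: right_diff_distrib)
    ultimately show ?thesis by simp
  qed
qed

lemma ap_weight_wraparound_le:
  assumes "x \<in> {0..1}" "y \<in> {0..1}" "z \<in> {0..1}" "x + y - 2 * z \<in> \<int>" "x + y - 2 * z \<noteq> 0" "0 < m"
  shows "ap_weight m x z \<le> 2 / (real m)\<^sup>2"
proof -
  let ?t = "(sin (pi * (x - z)))\<^sup>2"
  have t: "?t \<le> 1" by (simp add: abs_square_le_1)
  have "ap_weight m x z = (?t * (sin (pi * z))\<^sup>2) * (1 - ?t) ^ m"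
    by (simp add: ap_weight_def cos_squared_eq)
  also have "\<dots> \<le> (?t * ?t) * (1 - ?t) ^ m"
    using sin_le_abs_sin_of_wraparound[OF assms(1-5)] t by (intro mult_right_mono mult_left_mono) auto
  also have "\<dots> = ?t\<^sup>2 * (1 - ?t) ^ m" by (simp add: power2_eq_square)
  also have "\<dots> \<le> 2 / (real m)\<^sup>2" using t assms(6) by (intro sq_mult_power_le) auto
  finally show ?thesis .
qed

section \<open>Lower bound at one scale\<close>

text \<open>
  Half-open, so that cells are disjoint. The cells \<open>0, \<dots>, P\<close>, one more than \<open>P\<close>, cover the
  closed unit interval.\<close>

definition cell :: "nat \<Rightarrow> int \<Rightarrow> real set" where
  "cell P i = {real_of_int i / real P ..< (real_of_int i + 1) / real P}"

lemma mem_cell_iff: "0 < P \<Longrightarrow> x \<in> cell P i \<longleftrightarrow> \<lfloor>real P * x\<rfloor> = i"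
  by (auto simp: cell_def floor_eq_iff field_simps)

lemma cell_borel [measurable, simp]: "cell P i \<in> sets borel"
  by (simp add: cell_def)

text \<open>
  Comparing with the Lebesgue bound \<open>1 / P\<close>, the ball condition loses the factor \<open>P powr (1 - \<alpha>)\<close>.\<close>

lemma measure_cell_le:
  assumes \<mu>: "prob_space \<mu>" "sets \<mu> = sets borel"
    and ball: "\<And>x \<epsilon>. 0 < \<epsilon> \<Longrightarrow> \<epsilon> \<le> 1 \<Longrightarrow> measure \<mu> {x..x + \<epsilon>} \<le> C * \<epsilon> powr \<alpha>"
    and P: "0 < P" "real P powr (1 - \<alpha>) \<le> R" and C: "0 \<le> C"
  shows "measure \<mu> (cell P i) \<le> C * R / real P"
proof -
  interpret prob_space \<mu> by fact
  have "measure \<mu> (cell P i) \<le> measure \<mu> {real_of_int i / real P..real_of_int i / real P + 1 / real P}"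
    using \<mu>(2) by (intro finite_measure_mono) (auto simp: cell_def add_divide_distrib)
  also have "\<dots> \<le> C * (1 / real P) powr \<alpha>" using P by (intro ball) auto
  also have "(1 / real P) powr \<alpha> = real P powr (1 - \<alpha>) / real P"
    using P by (simp add: powr_divide powr_diff field_simps)
  also have "C * \<dots> \<le> C * (R / real P)" using P C by (intro mult_left_mono divide_right_mono) auto
  finally show ?thesis by simp
qed

lemma many_heavy_cells:
  fixes M :: real
  assumes \<mu>: "prob_space \<mu>" "sets \<mu> = sets borel" "measure \<mu> {0..1} = 1"
    and M: "1 \<le> M" and cells: "\<And>i. measure \<mu> (cell P i) \<le> M / real P" and P: "24 * M \<le> real P"
  shows "real P / (4 * M) \<le> real (card {i \<in> {0..int P}. real P / (16 * M) \<le> real_of_int i \<and>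
     real_of_int i \<le> real P - real P / (16 * M) - 1 \<and> 1 / (4 * real P) \<le> measure \<mu> (cell P i)})"
    (is "_ \<le> real (card ?A)")
proof -
  interpret prob_space \<mu> by fact
  have P0: "0 < real P" "24 \<le> real P" using M P by linarith+
  hence P0': "0 < P" by simp
  define w where "w i = measure \<mu> (cell P i)" for i
  define e where "e = \<lfloor>real P / (16 * M)\<rfloor>"
  \<comment> \<open>The cells outside the heavy set are either light, with total mass at most \<open>1 / 2\<close>, or one of the
    \<open>2 * e + 3\<close> cells near the ends of the unit interval, with total mass at most \<open>1 / 4\<close>.\<close>
  define edge where "edge = {0..e} \<union> {int P - e - 1..int P}"
  have e: "0 \<le> e" "real_of_int e \<le> real P / (16 * M)" using M P0 by (auto simp: e_def)
  have "{0..1} \<subseteq> (\<Union>i\<in>{0..int P}. cell P i)"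
  proof
    fix x :: real assume "x \<in> {0..1}"
    hence "0 \<le> real P * x" "real P * x \<le> real P" using P0 by (auto simp: mult_left_le)
    hence "\<lfloor>real P * x\<rfloor> \<in> {0..int P}" using floor_mono[of "real P * x" "real P"] by auto
    thus "x \<in> (\<Union>i\<in>{0..int P}. cell P i)" using mem_cell_iff[OF P0'] by auto
  qed
  moreover have "(\<Union>i\<in>{0..int P}. cell P i) \<in> sets \<mu>"
    unfolding \<mu>(2) by (rule sets.finite_UN) simp_all
  ultimately have "measure \<mu> {0..1} \<le> measure \<mu> (\<Union>i\<in>{0..int P}. cell P i)"
    by (rule finite_measure_mono)
  hence "1 \<le> measure \<mu> (\<Union>i\<in>{0..int P}. cell P i)" by (simp only: \<mu>(3))
  also have "\<dots> \<le> (\<Sum>i\<in>{0..int P}. w i)"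
    unfolding w_def by (intro finite_measure_subadditive_finite) (simp_all add: \<mu>(2) image_subset_iff)
  also have "\<dots> \<le> (\<Sum>i\<in>{0..int P}. (if i \<in> ?A then M / real P else 0) + 1 / (4 * real P) 
                  + (if i \<in> edge then M / real P else 0))"
  proof (rule sum_mono)
    fix i assume i: "i \<in> {0..int P}"
    have nn: "0 \<le> M / real P" "0 \<le> 1 / (4 * real P)" using M by auto
    have w: "w i \<le> M / real P" using cells by (simp add: w_def)
    let ?f = "if i \<in> ?A then M / real P else 0" and ?g = "if i \<in> edge then M / real P else 0"
    have fg: "0 \<le> ?f" "0 \<le> ?g" using nn by auto
    consider "i \<in> ?A" | "i \<in> edge" | "w i < 1 / (4 * real P)" | "i \<notin> ?A" "i \<notin> edge" "1 / (4 * real P) \<le> w i" by linarith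
    thus "w i \<le> (if i \<in> ?A then M / real P else 0) + 1 / (4 * real P) + (if i \<in> edge then M / real P else 0)"
    proof cases
      case 1
      hence "?f = M / real P" by (rule if_P)
      thus ?thesis using w nn fg by linarith
    next
      case 2
      hence "?g = M / real P" by (rule if_P)
      thus ?thesis using w nn fg by linarith
    next
      case 3
      thus ?thesis using fg by linarith
    next
      case 4
      hence "real_of_int i < real P / (16 * M) \<or> real P - real P / (16 * M) - 1 < real_of_int i"
        using i by (auto simp: w_def)
      hence "i \<in> edge"
      proof
        assume "real_of_int i < real P / (16 * M)"
        thus "i \<in> edge" using i by (auto simp: edge_def e_def le_floor_iff)
      next
        assume "real P - real P / (16 * M) - 1 < real_of_int i"
        hence "real P / (16 * M) > real_of_int (int P - i - 1)" by simp
        hence "int P - i - 1 \<le> e" by (simp add: e_def le_floor_iff)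
        thus "i \<in> edge" using i by (auto simp: edge_def)
      qed
      with 4 show ?thesis by simp
    qed
  qed
  also have "\<dots> = real (card ?A) * (M / real P) + (real P + 1) * (1 / (4 * real P)) 
     + (\<Sum>i\<in>{0..int P}. if i \<in> edge then M / real P else 0)"
  proof -
    have "(\<Sum>i\<in>{0..int P}. if i \<in> ?A then M / real P else 0) = (\<Sum>i\<in>?A. M / real P)"
      by (intro sum.mono_neutral_cong_right) auto
    moreover have "real (card {0..int P}) = real P + 1" by simp
    ultimately show ?thesis by (simp add: sum.distrib)
  qed
  also have "(\<Sum>i\<in>{0..int P}. if i \<in> edge then M / real P else 0) \<le> (real_of_int e * 2 + 3) * (M / real P)"
  proof -
    have "card edge \<le> card {0..e} + card {int P - e - 1..int P}" unfolding edge_def by (rule card_Un_le)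
    hence ce: "real (card edge) \<le> real_of_int e * 2 + 3" using e by simp
    have "(\<Sum>i\<in>{0..int P}. if i \<in> edge then M / real P else 0) = (\<Sum>i\<in>{0..int P} \<inter> edge. M / real P)"
      by (simp add: sum.If_cases)
    also have "\<dots> \<le> (\<Sum>i\<in>edge. M / real P)"
      using M by (intro sum_mono2) (auto simp: edge_def)
    also have "\<dots> = real (card edge) * (M / real P)" by simp
    also have "\<dots> \<le> (real_of_int e * 2 + 3) * (M / real P)" using ce M by (intro mult_right_mono) auto
    finally show ?thesis .
  qed
  also have "(real_of_int e * 2 + 3) * (M / real P) \<le> (real P / (16 * M) * 2 + 3) * (M / real P)"
    using e M by (intro mult_right_mono) auto
  also have "\<dots> = 1 / 8 + 3 * M / real P" using P0 M by (simp add: field_simps)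
  finally have "1 \<le> real (card ?A) * (M / real P) + (real P + 1) * (1 / (4 * real P)) + (1 / 8 + 3 * M / real P)"
    by simp
  moreover have "(real P + 1) * (1 / (4 * real P)) \<le> 1 / 2" using P0 by (simp add: field_simps)
  moreover have "3 * M / real P \<le> 1 / 8" using P P0 by (simp add: field_simps)
  ultimately have "1 / 4 \<le> real (card ?A) * (M / real P)" by linarith
  thus ?thesis using P0 M by (simp add: field_simps)
qed

lemma measure_triple_box:
  assumes \<mu>: "prob_space \<mu>" "sets \<mu> = sets borel" and "X \<in> sets borel" "Y \<in> sets borel" "Z \<in> sets borel"
  shows "measure (triple \<mu>) (X \<times> Y \<times> Z) = measure \<mu> X * (measure \<mu> Y * measure \<mu> Z)"
proof -
  interpret prob_space \<mu> by fact
  interpret p: pair_prob_space \<mu> \<mu> ..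
  interpret q: pair_prob_space \<mu> "\<mu> \<Otimes>\<^sub>M \<mu>" ..
  have "Y \<times> Z \<in> sets (\<mu> \<Otimes>\<^sub>M \<mu>)" using assms by auto
  thus ?thesis unfolding triple_def using assms
    by (simp add: measure_def p.P.emeasure_pair_measure_Times emeasure_pair_measure_Times enn2real_mult)
qed

text \<open>
  Three heavy cells in progression carry triples with \<open>\<bar>x + y - 2 * z\<bar> \<le> 2 / P = 1 / (6 * N)\<close>, where the
  kernel is at least \<open>N / 4\<close>. The relations between \<open>P\<close>, \<open>q\<close>, \<open>L\<close> and \<open>S\<close> put \<open>\<bar>x - z\<bar>\<close> between
  \<open>1 / (120 * L * q)\<close> and \<open>1 / (20 * q)\<close>, where the weight is of order \<open>q powr (- 2)\<close>; one further factor
  \<open>1 / q\<close> is the proportion of differences in that range.\<close>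

lemma fejer_ap_mass_ge:
  fixes M \<delta> :: real and L q S P N :: nat
  defines "\<delta> \<equiv> 1 / (4 * M)" and "P \<equiv> 60 * L * q * S" and "N \<equiv> 5 * L * q * S"
  assumes \<mu>: "prob_space \<mu>" "sets \<mu> = sets borel" "measure \<mu> {0..1} = 1"
    and M: "1 \<le> M" and cells: "\<And>i. measure \<mu> (cell P i) \<le> M / real P" and P: "24 * M \<le> real P"
    and L: "0 < L" and roth: "\<And>B. B \<subseteq> {0..<int L} \<Longrightarrow> \<delta> / 6 * real L \<le> real (card B) \<Longrightarrow> \<not> ap_free B"
    and q: "0 < q" and S: "2 \<le> S"
  shows "1 / (10 ^ 15 * M ^ 3 * real L ^ 5 * real q ^ 3)
     \<le> (LINT (x, y, z)|triple \<mu>. fejer N (x + y - 2 * z) * ap_weight (q\<^sup>2) x z)"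
proof -
  define \<eta> where "\<eta> = 1 / (16 * M)"
  define A where "A = {i \<in> {0..int P}. real P / (16 * M) \<le> real_of_int i \<and>
     real_of_int i \<le> real P - real P / (16 * M) - 1 \<and> 1 / (4 * real P) \<le> measure \<mu> (cell P i)}"
  define X where "X = {(x, D). x \<in> A \<and> x + D \<in> A \<and> x + 2 * D \<in> A \<and> int S \<le> D \<and> D \<le> int (2 * S * L)}"
  \<comment> \<open>The second coordinate belongs to the far end of the progression and the third to its midpoint.\<close>
  define box where "box = (\<lambda>(i, D). cell P i \<times> cell P (i + 2 * D) \<times> cell P (i + D))"
  define h where "h = real N / 4 * ((1 / (120 * real L * real q))\<^sup>2 * \<eta>\<^sup>2 / 2)"
  have P0: "0 < P" "0 < real P" using L q S by (auto simp: P_def)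
  have N0: "0 < N" using L q S by (auto simp: N_def)
  have PN: "real P = 12 * real N" by (simp add: P_def N_def)
  have \<eta>: "0 \<le> \<eta>" "\<eta> \<le> 1 / 3" using M by (auto simp: \<eta>_def field_simps)
  interpret Q: prob_space "triple \<mu>" using prob_space_triple \<mu>(1) .
  have finA: "finite A" by (rule finite_subset[of _ "{0..int P}"]) (auto simp: A_def)
  have finX: "finite X"
    by (rule finite_subset[of _ "A \<times> {int S..int (2 * S * L)}"]) (use finA in \<open>auto simp: X_def\<close>)
  have "\<delta> * real S * real P / (2 * (real L)\<^sup>2) \<le> real (card X)"
    unfolding X_def
  proof (rule many_progressions_of_dense_set[OF L roth])
    show "\<delta> * real P \<le> real (card A)"
      using many_heavy_cells[OF \<mu> M cells P] by (simp add: A_def \<delta>_def)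
    have "2 * (S * L) \<le> 60 * q * (S * L)" using q by (intro mult_right_mono) auto
    thus "2 * S * L \<le> P" by (simp add: P_def mult_ac)
  qed (use M S in \<open>auto simp: \<delta>_def A_def\<close>)
  hence cX: "real S * real P / (8 * M * (real L)\<^sup>2) \<le> real (card X)" by (simp add: \<delta>_def mult_ac)
  have box_sets: "box p \<in> sets (triple \<mu>)" for p
    by (auto simp: box_def triple_def \<mu>(2) split: prod.split)
  have box_measure: "1 / (64 * real P ^ 3) \<le> measure (triple \<mu>) (box p)" if "p \<in> X" for p
  proof -
    obtain i D where p: "p = (i, D)" by (cases p)
    have "i \<in> A" "i + D \<in> A" "i + 2 * D \<in> A" using that by (auto simp: p X_def)
    hence "1 / (4 * real P) * (1 / (4 * real P) * (1 / (4 * real P))) 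
       \<le> measure \<mu> (cell P i) * (measure \<mu> (cell P (i + 2 * D)) * measure \<mu> (cell P (i + D)))"
      by (intro mult_mono) (auto simp: A_def)
    thus ?thesis by (simp add: p box_def measure_triple_box[OF \<mu>(1,2)] power3_eq_cube mult_ac)
  qed
  have "disjoint_family_on box X"
    unfolding disjoint_family_on_def box_def using mem_cell_iff[OF P0(1)] by (auto split: prod.splits)
  hence "measure (triple \<mu>) (\<Union>(box ` X)) = (\<Sum>p\<in>X. measure (triple \<mu>) (box p))"
    using box_sets finX by (intro measure_finite_Union) auto
  also have "\<dots> \<ge> (\<Sum>p\<in>X. 1 / (64 * real P ^ 3))" by (intro sum_mono box_measure)
  finally have mU: "real (card X) / (64 * real P ^ 3) \<le> measure (triple \<mu>) (\<Union>(box ` X))" by simp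
  have h0: "0 \<le> h" by (simp add: h_def)
  have pointwise: "h \<le> fejer N (x + y - 2 * z) * ap_weight (q\<^sup>2) x z" if mem: "(x, y, z) \<in> \<Union>(box ` X)" for x y z
  proof -
    obtain p where p: "p \<in> X" "(x, y, z) \<in> box p" using mem by blast
    obtain i D where [simp]: "p = (i, D)" by (cases p)
    have iD: "(i, D) \<in> X" "x \<in> cell P i" "y \<in> cell P (i + 2 * D)" "z \<in> cell P (i + D)"
      using p by (auto simp: box_def)
    have D: "real S \<le> real_of_int D" "real_of_int D \<le> 2 * real S * real L" 
    proof -
      have "int S \<le> D" "D \<le> int (2 * S * L)" using iD(1) by (auto simp: X_def)
      hence "real_of_int (int S) \<le> real_of_int D" "real_of_int D \<le> real_of_int (int (2 * S * L))"
        unfolding of_int_le_iff .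
      thus "real S \<le> real_of_int D" "real_of_int D \<le> 2 * real S * real L" by simp_all
    qed
    have x: "real_of_int i \<le> real P * x" "real P * x < real_of_int i + 1"
      and y: "real_of_int i + 2 * real_of_int D \<le> real P * y" "real P * y < real_of_int i + 2 * real_of_int D + 1"
      and z: "real_of_int i + real_of_int D \<le> real P * z" "real P * z < real_of_int i + real_of_int D + 1"
      using iD(2-4) P0 by (auto simp: cell_def field_simps)
    have "real P * (x + y - 2 * z) \<le> 2" "- 2 \<le> real P * (x + y - 2 * z)"
      using x y z by (simp_all add: algebra_simps)
    hence "\<bar>x + y - 2 * z\<bar> \<le> 2 / real P" using P0 by (simp add: abs_le_iff field_simps)
    hence f: "real N / 4 \<le> fejer N (x + y - 2 * z)"
      using N0 PN by (intro fejer_ge) (auto simp: field_simps)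
    have Pd: "real_of_int D - 1 \<le> real P * (z - x)" "real P * (z - x) \<le> real_of_int D + 1"
      using x z by (simp_all add: algebra_simps)
    have S2: "2 \<le> real S" using S by simp
    have L1: "1 \<le> real L" using L by simp
    have "real S * 1 \<le> real S * real L" using L1 by (intro mult_left_mono) auto
    hence "real P * (z - x) \<le> 3 * (real S * real L)" "real S / 2 \<le> real P * (z - x)"
      using Pd D S2 by linarith+
    hence up: "z - x \<le> 3 * (real S * real L) / real P" and lo: "real S / 2 / real P \<le> z - x"
      using P0 by (simp_all add: field_simps)
    have "real S / 2 / real P = 1 / (120 * real L * real q)" "3 * (real S * real L) / real P = 1 / (20 * real q)"
      using L q S2 by (simp_all add: P_def field_simps)
    with up lo have d: "z - x \<le> 1 / (20 * real q)" "1 / (120 * real L * real q) \<le> z - x" by simp_all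
    have "0 \<le> 1 / (120 * real L * real q)" by simp
    hence "0 \<le> z - x" using d(2) by linarith
    moreover have "1 / (20 * real q) \<le> 1 / (10 * real q)" using q by (simp add: field_simps)
    ultimately have d': "\<bar>x - z\<bar> \<le> 1 / (10 * real q)" using d(1) by linarith
    have "i + D \<in> A" using iD(1) by (auto simp: X_def)
    hence "real P * \<eta> \<le> real_of_int i + real_of_int D" "real_of_int i + real_of_int D \<le> real P - real P * \<eta> - 1"
      by (auto simp: A_def \<eta>_def)
    hence "real P * \<eta> \<le> real P * z" "real P * z \<le> real P * (1 - \<eta>)" using z by (simp_all add: algebra_simps)
    hence z': "\<eta> \<le> z" "z \<le> 1 - \<eta>" using P0 by simp_all
    have "(1 / (120 * real L * real q))\<^sup>2 \<le> (z - x)\<^sup>2" using d(2) by (intro power_mono) auto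
    also have "(z - x)\<^sup>2 = (x - z)\<^sup>2" by (rule power2_commute)
    finally have "(1 / (120 * real L * real q))\<^sup>2 * \<eta>\<^sup>2 / 2 \<le> (x - z)\<^sup>2 * \<eta>\<^sup>2 / 2"
      by (intro divide_right_mono mult_right_mono) auto
    also have "\<dots> \<le> ap_weight (q\<^sup>2) x z" by (rule ap_weight_ge[OF q d' \<eta> z'])
    finally show ?thesis unfolding h_def using f by (intro mult_mono) auto
  qed
  have "h * (real (card X) / (64 * real P ^ 3)) \<le> h * measure (triple \<mu>) (\<Union>(box ` X))"
    using mU h0 by (rule mult_left_mono)
  also have "\<dots> = (LINT p|triple \<mu>. h * indicator (\<Union>(box ` X)) p)"
    using box_sets finX by (simp add: Int_absorb2 sets.sets_into_space)
  also have "\<dots> \<le> (LINT (x, y, z)|triple \<mu>. fejer N (x + y - 2 * z) * ap_weight (q\<^sup>2) x z)"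
  proof (rule integral_mono)
    show "integrable (triple \<mu>) (\<lambda>p. h * indicator (\<Union>(box ` X)) p)"
      using box_sets finX by (intro integrable_mult_right integrable_real_indicator) (auto simp: less_top[symmetric])
    show "integrable (triple \<mu>) (\<lambda>(x, y, z). fejer N (x + y - 2 * z) * ap_weight (q\<^sup>2) x z)"
    proof (rule integrable_triple[OF \<mu>(1,2)])
      show "norm (case p of (x, y, z) \<Rightarrow> fejer N (x + y - 2 * z) * ap_weight (q\<^sup>2) x z) \<le> real N * 1" for p
        unfolding split_beta norm_mult 
        by (intro mult_mono) (auto simp: fejer_le_self ap_weight_nonneg ap_weight_le_1)
    qed (auto simp: split_beta intro!: continuous_intros)
    show "h * indicator (\<Union>(box ` X)) p \<le> (case p of (x, y, z) \<Rightarrow> fejer N (x + y - 2 * z) * ap_weight (q\<^sup>2) x z)" for p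
      using pointwise[of "fst p" "fst (snd p)" "snd (snd p)"] ap_weight_nonneg
      by (auto simp: split_beta indicator_def)
  qed
  finally have T: "h * (real (card X) / (64 * real P ^ 3)) 
     \<le> (LINT (x, y, z)|triple \<mu>. fejer N (x + y - 2 * z) * ap_weight (q\<^sup>2) x z)" .
  have "1 / (10 ^ 15 * M ^ 3 * real L ^ 5 * real q ^ 3) \<le> h * (real S * real P / (8 * M * (real L)\<^sup>2) / (64 * real P ^ 3))"
  proof -
    have "h * (real S * real P / (8 * M * (real L)\<^sup>2) / (64 * real P ^ 3)) 
       = 1 / (57600 * 262144 * 720 * M ^ 3 * real L ^ 5 * real q ^ 3)"
      using L q S M unfolding h_def \<eta>_def P_def N_def
      by (simp add: field_simps power2_eq_square eval_nat_numeral)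
    also have "\<dots> \<ge> 1 / (10 ^ 15 * M ^ 3 * real L ^ 5 * real q ^ 3)"
      using L q M by (intro divide_left_mono mult_right_mono mult_pos_pos) auto
    finally show ?thesis by simp
  qed
  also have "\<dots> \<le> h * (real (card X) / (64 * real P ^ 3))"
    using cX h0 by (intro mult_left_mono divide_right_mono) auto
  also note T
  finally show ?thesis .
qed

section \<open>Upper bound in the limit\<close>

text \<open>
  On the compact set of triples in \<open>E\<close> whose weight is at least \<open>3 / m\<^sup>2\<close>, the number \<open>x + y - 2 * z\<close> is
  never an integer, so the kernel tends to \<open>0\<close> uniformly there. The constant \<open>\<rho>\<close> depends on \<open>E\<close>, which is
  harmless because \<open>n\<close> tends to infinity while everything else is fixed.\<close>

lemma fejer_mass_upper_bound:
  assumes E: "closed E" "E \<subseteq> {0..1}" "\<not> has_nontrivial_3AP E" and \<mu>: "supports_prob_measure E \<mu>" and m: "0 < m"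
  shows "\<exists>\<rho>>0. \<forall>n>0. (LINT (x, y, z)|triple \<mu>. fejer n (x + y - 2 * z) * ap_weight m x z) \<le>
     3 / (real m)\<^sup>2 * (LINT (x, y, z)|triple \<mu>. fejer n (x + y - 2 * z)) + \<rho> / real n"
proof -
  have \<mu>': "prob_space \<mu>" "sets \<mu> = sets borel" "measure \<mu> E = 1"
    using \<mu> by (auto simp: supports_prob_measure_def)
  interpret Q: prob_space "triple \<mu>" using prob_space_triple \<mu>'(1) .
  define K where "K = (E \<times> E \<times> E) \<inter> {p. 3 / (real m)\<^sup>2 \<le> ap_weight m (fst p) (snd (snd p))}"
  define g where "g p = cmod (unit_exp (fst p + fst (snd p) - 2 * snd (snd p)) - 1)" for p :: "real \<times> real \<times> real"
  have "compact E" using E by (metis compact_Icc compact_Int_closed inf.absorb_iff2)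
  hence "compact K" unfolding K_def
    by (intro compact_Int_closed compact_Times closed_Collect_le continuous_intros)
  \<comment> \<open>A zero of \<open>g\<close> on \<open>K\<close> is a progression modulo \<open>1\<close>: a genuine one is trivial and has weight \<open>0\<close>,
    and the others have too small a weight to lie in \<open>K\<close>.\<close>
  have g_pos: "0 < g p" if "p \<in> K" for p
  proof (rule ccontr)
    assume "\<not> 0 < g p"
    obtain x y z where p: "p = (x, y, z)" by (cases p)
    have xyz: "x \<in> E" "y \<in> E" "z \<in> E" and w: "3 / (real m)\<^sup>2 \<le> ap_weight m x z"
      using that by (auto simp: K_def p)
    have m3: "0 < 3 / (real m)\<^sup>2" "2 / (real m)\<^sup>2 < 3 / (real m)\<^sup>2" 
      using m by (simp_all add: divide_strict_right_mono)
    have "unit_exp (x + y - 2 * z) = 1" using \<open>\<not> 0 < g p\<close> by (simp add: g_def p)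
    hence int: "x + y - 2 * z \<in> \<int>" by (simp add: unit_exp_eq_1_iff)
    show False
    proof (cases "x + y - 2 * z = 0")
      case True
      hence "(x + y) / 2 = z" by simp
      hence "x = y" using E(3) xyz unfolding has_nontrivial_3AP_def by metis
      hence "ap_weight m x z = 0" using True by (simp add: ap_weight_def)
      thus False using w m3 by linarith
    next
      case False
      hence "ap_weight m x z \<le> 2 / (real m)\<^sup>2"
        using xyz E(2) int m by (intro ap_weight_wraparound_le[of x y z]) auto
      thus False using w m3 by linarith
    qed
  qed
  have "\<exists>r>0. \<forall>p\<in>K. r \<le> g p"
  proof (cases "K = {}")
    case False
    have "continuous_on K g" unfolding g_def by (intro continuous_intros)
    then obtain p where "p \<in> K" "\<forall>p'\<in>K. g p \<le> g p'"
      using continuous_attains_inf[OF \<open>compact K\<close> False] by blast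
    thus ?thesis using g_pos by blast
  qed (auto intro: exI[of _ 1])
  then obtain r where r: "0 < r" "\<And>p. p \<in> K \<Longrightarrow> r \<le> g p" by blast
  show ?thesis
  proof (intro exI[of _ "4 / r\<^sup>2"] conjI allI impI)
    fix n :: nat assume n: "0 < n"
    have pw: "fejer n (x + y - 2 * z) * ap_weight m x z 
       \<le> 3 / (real m)\<^sup>2 * fejer n (x + y - 2 * z) + 4 / r\<^sup>2 / real n"
      if "(x, y, z) \<in> E \<times> E \<times> E" for x y z
    proof (cases "(x, y, z) \<in> K")
      case True
      hence gr: "r \<le> cmod (unit_exp (x + y - 2 * z) - 1)" using r(2)[OF True] by (simp add: g_def)
      have ne: "0 < cmod (unit_exp (x + y - 2 * z) - 1)" using gr r(1) by linarith
      have "fejer n (x + y - 2 * z) * ap_weight m x z \<le> fejer n (x + y - 2 * z)"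
        by (intro mult_left_le) (auto simp: ap_weight_le_1)
      also have "\<dots> \<le> 4 / (real n * (cmod (unit_exp (x + y - 2 * z) - 1))\<^sup>2)"
        using ne by (intro fejer_le) auto
      also have "\<dots> \<le> 4 / (real n * r\<^sup>2)"
        using gr r(1) n ne by (intro divide_left_mono mult_left_mono power_mono mult_pos_pos zero_less_power) auto
      also have "\<dots> = 4 / r\<^sup>2 / real n" by simp
      also have "\<dots> \<le> 3 / (real m)\<^sup>2 * fejer n (x + y - 2 * z) + 4 / r\<^sup>2 / real n" by simp
      finally show ?thesis .
    next
      case False
      hence "ap_weight m x z \<le> 3 / (real m)\<^sup>2" using that by (auto simp: K_def)
      hence "fejer n (x + y - 2 * z) * ap_weight m x z \<le> fejer n (x + y - 2 * z) * (3 / (real m)\<^sup>2)"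
        by (intro mult_left_mono) auto
      moreover have "0 \<le> 4 / r\<^sup>2 / real n" by simp
      ultimately show ?thesis unfolding mult.commute[of "3 / (real m)\<^sup>2"] by linarith
    qed
    have "E \<in> sets borel" using E(1) by auto
    hence "measure (triple \<mu>) (E \<times> E \<times> E) = 1"
      using measure_triple_box[OF \<mu>'(1,2)] \<mu>'(3) by simp
    hence ae: "AE p in triple \<mu>. p \<in> E \<times> E \<times> E" by (rule Q.AE_prob_1)
    have int1: "integrable (triple \<mu>) (\<lambda>(x, y, z). fejer n (x + y - 2 * z))"
      using integrable_fejer_mult[OF \<mu>'(1,2), of "\<lambda>_ _. 1"] trig_avg_1 by simp
    have "(LINT (x, y, z)|triple \<mu>. fejer n (x + y - 2 * z) * ap_weight m x z) 
       \<le> (LINT p|triple \<mu>. 3 / (real m)\<^sup>2 * (case p of (x, y, z) \<Rightarrow> fejer n (x + y - 2 * z)) + 4 / r\<^sup>2 / real n)"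
    proof (rule integral_mono_AE)
      show "integrable (triple \<mu>) (\<lambda>(x, y, z). fejer n (x + y - 2 * z) * ap_weight m x z)"
        by (rule integrable_fejer_mult[OF \<mu>'(1,2) trig_avg_ap_weight])
      show "integrable (triple \<mu>) (\<lambda>p. 3 / (real m)\<^sup>2 * (case p of (x, y, z) \<Rightarrow> fejer n (x + y - 2 * z)) + 4 / r\<^sup>2 / real n)"
        using int1 by (intro Bochner_Integration.integrable_add integrable_mult_right) auto
      show "AE p in triple \<mu>. (case p of (x, y, z) \<Rightarrow> fejer n (x + y - 2 * z) * ap_weight m x z)
         \<le> 3 / (real m)\<^sup>2 * (case p of (x, y, z) \<Rightarrow> fejer n (x + y - 2 * z)) + 4 / r\<^sup>2 / real n"
        using ae by eventually_elim (use pw in auto)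
    qed
    also have "\<dots> = 3 / (real m)\<^sup>2 * (LINT (x, y, z)|triple \<mu>. fejer n (x + y - 2 * z)) + 4 / r\<^sup>2 / real n"
      using int1 Q.prob_space by (subst Bochner_Integration.integral_add) auto
    finally show "(LINT (x, y, z)|triple \<mu>. fejer n (x + y - 2 * z) * ap_weight m x z) \<le>
     3 / (real m)\<^sup>2 * (LINT (x, y, z)|triple \<mu>. fejer n (x + y - 2 * z)) + 4 / r\<^sup>2 / real n" .
  qed (use r in auto)
qed

text \<open>
  The chain of inequalities: the mass at scale \<open>1 / N\<close> is at most the mass at scale \<open>1 / n\<close> plus the Fourier
  error, and the latter mass is at most \<open>3 / q ^ 4\<close> times the unweighted one, up to a term vanishing as
  \<open>n\<close> tends to infinity. The conclusion is this chain multiplied by \<open>q ^ 4\<close>.\<close>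

lemma fejer_masses_incompatible:
  fixes A \<beta> Z c :: real and q N :: nat
  defines "s \<equiv> (3 * \<beta> / 2 - 1) / 6" and "\<sigma> \<equiv> (3 * \<beta> / 2 + 1) / 2"
  assumes E: "closed E" "E \<subseteq> {0..1}" "\<not> has_nontrivial_3AP E" and \<mu>: "supports_prob_measure E \<mu>" 
    and \<beta>: "2 / 3 < \<beta>" "\<beta> \<le> 1"
    and decay: "\<And>k. cmod (exp_mean \<mu> k) \<le> A * max 1 \<bar>real_of_int k\<bar> powr (- \<beta> / 2)"
    and A: "0 \<le> A" and Z: "\<And>F :: int set. finite F \<Longrightarrow> (\<Sum>k\<in>F. max 1 \<bar>real_of_int k\<bar> powr (- \<sigma>)) \<le> Z"
    and q: "0 < q" and N: "0 < N"
    and lower: "c / real q ^ 3 \<le> (LINT (x, y, z)|triple \<mu>. fejer N (x + y - 2 * z) * ap_weight (q\<^sup>2) x z)"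
  shows "c * real q \<le> 3 * (1 + A ^ 3 * Z) + real q ^ 4 * (A ^ 3 * Z) * real N powr (- s)"
proof -
  have \<mu>': "prob_space \<mu>" "sets \<mu> = sets borel"
    using \<mu> by (auto simp: supports_prob_measure_def)
  interpret Q: prob_space "triple \<mu>" using prob_space_triple \<mu>'(1) .
  have diff: "\<bar>(LINT (x, y, z)|triple \<mu>. fejer n (x + y - 2 * z) * f x z) 
       - (LINT (x, y, z)|triple \<mu>. fejer k (x + y - 2 * z) * f x z)\<bar> \<le> A ^ 3 * Z * real k powr (- s)"
    if "0 < k" "k \<le> n" "trig_avg (\<lambda>x z. complex_of_real (f x z))" for f k n
    unfolding s_def by (rule fejer_mass_difference[OF \<mu>' \<beta> decay A Z[unfolded \<sigma>_def] that])
  define U where "U n = (LINT (x, y, z)|triple \<mu>. fejer n (x + y - 2 * z))" for n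
  define T where "T n = (LINT (x, y, z)|triple \<mu>. fejer n (x + y - 2 * z) * ap_weight (q\<^sup>2) x z)" for n
  \<comment> \<open>The kernel of order \<open>1\<close> is constant, so comparison with it bounds every unweighted mass.\<close>
  have "U 1 = 1" unfolding U_def fejer_1 using Q.prob_space by (simp add: split_beta')
  hence U: "U n \<le> 1 + A ^ 3 * Z" if "1 \<le> n" for n
    using diff[of 1 n "\<lambda>_ _. 1"] that trig_avg_1 by (simp add: U_def)
  obtain \<rho> where \<rho>: "\<And>n. 0 < n \<Longrightarrow> T n \<le> 3 / (real (q\<^sup>2))\<^sup>2 * U n + \<rho> / real n"
    using fejer_mass_upper_bound[OF E \<mu>, of "q\<^sup>2"] q unfolding T_def U_def by auto
  \<comment> \<open>The constant \<open>\<rho>\<close> is not controlled uniformly in \<open>E\<close>, but its term disappears as \<open>n\<close> grows.\<close>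
  let ?R = "3 / real q ^ 4 * (1 + A ^ 3 * Z) + A ^ 3 * Z * real N powr (- s)"
  have "c / real q ^ 3 \<le> ?R + \<rho> / real n" if n: "N \<le> n" for n
  proof -
    have "c / real q ^ 3 \<le> T N" using lower by (simp add: T_def)
    also have "T N \<le> T n + A ^ 3 * Z * real N powr (- s)"
      using diff[OF N n trig_avg_ap_weight[of "q\<^sup>2"], folded T_def] by linarith
    also have "T n \<le> 3 / (real (q\<^sup>2))\<^sup>2 * U n + \<rho> / real n" using N n by (intro \<rho>) auto
    also have "3 / (real (q\<^sup>2))\<^sup>2 * U n \<le> 3 / (real (q\<^sup>2))\<^sup>2 * (1 + A ^ 3 * Z)"
      using N n by (intro mult_left_mono U) auto
    finally show ?thesis by (simp add: power_mult[symmetric])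
  qed
  moreover have "(\<lambda>n. ?R + \<rho> / real n) \<longlonglongrightarrow> ?R + 0"
    by (intro tendsto_add tendsto_const tendsto_divide_0[OF tendsto_const] 
        filterlim_at_top_imp_at_infinity filterlim_real_sequentially)
  ultimately have "c / real q ^ 3 \<le> ?R + 0" by (intro LIMSEQ_le_const) auto
  hence "real q ^ 4 * (c / real q ^ 3) \<le> real q ^ 4 * ?R" by (intro mult_left_mono) auto
  moreover have "real q ^ 4 * (c / real q ^ 3) = c * real q"
    using q by (simp add: eval_nat_numeral)
  moreover have "real q ^ 4 * (3 / real q ^ 4 * w) = 3 * w" for w
    using q by simp
  ultimately show ?thesis using q by (simp add: distrib_left mult.assoc)
qed

section \<open>Choice of parameters\<close>

text \<open>
  Here \<open>K * u powr (3 * b)\<close> is the cube of the constant in the Fourier decay. After division by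
  \<open>u powr (3 * b)\<close> the last inequality compares a bounded quantity with \<open>c * u\<close>.\<close>

lemma eventually_parameters:
  fixes b c s Z K L M :: real
  assumes "0 < c" "0 < s" "0 \<le> b" "0 < L"
  shows "eventually (\<lambda>u. 240 * L * u powr (3 * b + 1) \<le> exp u \<and> 24 * M \<le> exp u \<and> 1 \<le> u \<and>
     3 * (1 + K * u powr (3 * b) * Z) + 16 * u powr (12 * b + 4) * (K * u powr (3 * b) * Z) * exp (- s * u) 
       < c * u powr (3 * b + 1)) at_top"
proof -
  have "eventually (\<lambda>u. 240 * L * u powr (3 * b + 1) \<le> exp u) at_top" using assms by real_asymp
  moreover have "eventually (\<lambda>u. 24 * M \<le> exp u) at_top" by real_asymp
  moreover have "eventually (\<lambda>u::real. 1 \<le> u) at_top" by real_asymp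
  moreover have "((\<lambda>u. 16 * K * Z * (u powr (15 * b + 4) * exp (- s * u)) + 3) \<longlongrightarrow> 3) at_top"
    using assms by real_asymp
  hence "eventually (\<lambda>u. 16 * K * Z * (u powr (15 * b + 4) * exp (- s * u)) + 3 < 4) at_top"
    by (rule order_tendstoD) simp
  moreover have "eventually (\<lambda>u. 4 + 3 * K * Z < c * u) at_top" using assms by real_asymp
  ultimately show ?thesis
  proof eventually_elim
    case (elim u)
    have p1: "1 \<le> u powr (3 * b)" using elim assms by (intro ge_one_powr_ge_zero) auto
    have e1: "u powr (12 * b + 4) * u powr (3 * b) = u powr (15 * b + 4)" by (simp add: powr_add[symmetric])
    have e2: "u powr (3 * b + 1) = u powr (3 * b) * u" using elim by (simp add: powr_add)
    have "3 * (1 + K * u powr (3 * b) * Z) + 16 * u powr (12 * b + 4) * (K * u powr (3 * b) * Z) * exp (- s * u) 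
       = 3 * K * Z * u powr (3 * b) + (16 * K * Z * (u powr (15 * b + 4) * exp (- s * u)) + 3)"
      unfolding e1[symmetric] by (simp add: algebra_simps)
    also have "\<dots> \<le> 3 * K * Z * u powr (3 * b) + 4 * u powr (3 * b)"
      using elim p1 by linarith
    also have "\<dots> = (4 + 3 * K * Z) * u powr (3 * b)" by (simp add: algebra_simps)
    also have "\<dots> < (c * u) * u powr (3 * b)" using elim p1 by (intro mult_strict_right_mono) auto
    finally show ?case using elim e2 by (simp add: mult_ac)
  qed
qed

lemma ceiling_parameters:
  fixes X V M :: real and L :: nat
  defines "q \<equiv> nat \<lceil>X\<rceil>" and "S \<equiv> nat \<lceil>V\<rceil>"
  defines "P \<equiv> 60 * L * q * S"
  assumes "1 \<le> X" "1 < V" "0 < L" "240 * real L * X \<le> V" "24 * M \<le> V"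
  shows "X \<le> real q" "real q \<le> 2 * X" "V \<le> real S" "2 \<le> S" "real P \<le> V\<^sup>2" "24 * M \<le> real P" "V \<le> real (5 * L * q * S)"
proof -
  show q: "X \<le> real q" "real q \<le> 2 * X" using assms(4) unfolding q_def by linarith+
  have S: "V \<le> real S" "real S \<le> 2 * V" using assms(5) unfolding S_def by linarith+
  show "V \<le> real S" by fact
  show "2 \<le> S" using assms(5) unfolding S_def by linarith
  have "real P \<le> 60 * real L * (2 * X) * (2 * V)"
    unfolding P_def of_nat_mult of_nat_numeral using q S by (intro mult_mono) auto
  also have "\<dots> = (240 * real L * X) * V" by simp
  also have "\<dots> \<le> V * V" using assms by (intro mult_right_mono) auto
  finally show "real P \<le> V\<^sup>2" by (simp add: power2_eq_square)
  have Lq: "1 \<le> L * q" using assms q by (auto simp: Suc_le_eq)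
  hence "1 * S \<le> (L * q) * S" by (rule mult_right_mono) simp
  hence "S \<le> 5 * L * q * S" "5 * L * q * S \<le> P" by (auto simp: P_def mult_ac)
  hence "real S \<le> real (5 * L * q * S)" "real (5 * L * q * S) \<le> real P" unfolding of_nat_le_iff .
  thus "V \<le> real (5 * L * q * S)" "24 * M \<le> real P" using S assms by linarith+
qed

theorem theorem1p2:
  fixes C\<^sub>1 C\<^sub>2 B \<beta> :: real
  assumes "C\<^sub>1 > 0" and "C\<^sub>2 > 0" and "2 / 3 < \<beta>" and "\<beta> \<le> 1"
  shows "\<exists>\<epsilon>\<^sub>0>0. \<forall>(\<alpha>::real) (E::real set) (\<mu>::real measure).
           0 < \<alpha> \<longrightarrow> \<alpha> < 1 \<longrightarrow> \<alpha> > 1 - \<epsilon>\<^sub>0 \<longrightarrow>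
           closed E \<longrightarrow> E \<subseteq> {0..1} \<longrightarrow>
           supports_prob_measure E \<mu> \<longrightarrow>
           (\<forall>x \<epsilon>. 0 < \<epsilon> \<longrightarrow> \<epsilon> \<le> 1 \<longrightarrow> measure \<mu> {x..x + \<epsilon>} \<le> C\<^sub>1 * \<epsilon> powr \<alpha>) \<longrightarrow>
           (\<forall>k::int. k \<noteq> 0 \<longrightarrow>
              cmod (fourier_coeff \<mu> k)
                \<le> C\<^sub>2 * (1 - \<alpha>) powr (- B) * real_of_int \<bar>k\<bar> powr (- \<beta> / 2)) \<longrightarrow>
           has_nontrivial_3AP E"
proof -
  define s where "s = (3 * \<beta> / 2 - 1) / 6"
  define \<sigma> where "\<sigma> = (3 * \<beta> / 2 + 1) / 2"
  have s: "0 < s" and \<sigma>: "1 < \<sigma>" using assms(3) by (simp_all add: s_def \<sigma>_def)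
  obtain Z where Z: "0 \<le> Z" "\<And>F :: int set. finite F \<Longrightarrow> (\<Sum>k\<in>F. max 1 \<bar>real_of_int k\<bar> powr (- \<sigma>)) \<le> Z"
    using sum_powr_int_bounded[OF \<sigma>] by blast
  define M where "M = max 1 (C\<^sub>1 * exp 2)"
  have M: "1 \<le> M" "C\<^sub>1 * exp 2 \<le> M" by (simp_all add: M_def)
  have "0 < 1 / (4 * M) / 6" using M by simp
  from roth_theorem[OF this] obtain L where L: "0 < L" 
    "\<And>A. A \<subseteq> {0..<int L} \<Longrightarrow> 1 / (4 * M) / 6 * real L \<le> real (card A) \<Longrightarrow> \<not> ap_free A" by blast
  define c where "c = 1 / (10 ^ 15 * M ^ 3 * real L ^ 5)"
  have c: "0 < c" using M L by (simp add: c_def)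
  define b where "b = max B 0"
  have b: "B \<le> b" "0 \<le> b" by (simp_all add: b_def)
  define K where "K = (1 + C\<^sub>2) ^ 3"
  have L': "0 < real L" using L by simp
  obtain u\<^sub>0 where u\<^sub>0: "\<And>u. u\<^sub>0 \<le> u \<Longrightarrow> 240 * real L * u powr (3 * b + 1) \<le> exp u \<and> 24 * M \<le> exp u \<and> 1 \<le> u \<and>
     3 * (1 + K * u powr (3 * b) * Z) + 16 * u powr (12 * b + 4) * (K * u powr (3 * b) * Z) * exp (- s * u) 
       < c * u powr (3 * b + 1)"
    using eventually_parameters[OF c s b(2) L', of M K Z] unfolding eventually_at_top_linorder by blast
  show ?thesis
  proof (intro exI[of _ "1 / max 1 u\<^sub>0"] conjI allI impI)
    fix \<alpha> :: real and E :: "real set" and \<mu> :: "real measure"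
    assume \<alpha>: "0 < \<alpha>" "\<alpha> < 1" "1 - 1 / max 1 u\<^sub>0 < \<alpha>" and E: "closed E" "E \<subseteq> {0..1}"
      and \<mu>: "supports_prob_measure E \<mu>"
      and ball: "\<forall>x \<epsilon>. 0 < \<epsilon> \<longrightarrow> \<epsilon> \<le> 1 \<longrightarrow> measure \<mu> {x..x + \<epsilon>} \<le> C\<^sub>1 * \<epsilon> powr \<alpha>"
      and four: "\<forall>k::int. k \<noteq> 0 \<longrightarrow> cmod (fourier_coeff \<mu> k)
                \<le> C\<^sub>2 * (1 - \<alpha>) powr (- B) * real_of_int \<bar>k\<bar> powr (- \<beta> / 2)"
    show "has_nontrivial_3AP E"
    proof (rule ccontr)
      assume no_AP: "\<not> has_nontrivial_3AP E"
      have \<mu>': "prob_space \<mu>" "sets \<mu> = sets borel" "measure \<mu> E = 1"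
        using \<mu> by (auto simp: supports_prob_measure_def)
      interpret prob_space \<mu> by fact
      have \<mu>01: "measure \<mu> {0..1} = 1"
        using finite_measure_mono[OF E(2)] \<mu>'(2,3) prob_le_1[of "{0..1}"] by simp
      define u where "u = 1 / (1 - \<alpha>)"
      have "(1 - \<alpha>) * max 1 u\<^sub>0 \<le> 1" using \<alpha>(3) by (simp add: field_simps)
      hence "max 1 u\<^sub>0 \<le> u" unfolding u_def using \<alpha>(2) by (subst pos_le_divide_eq) (simp_all add: mult.commute)
      hence "u\<^sub>0 \<le> u" by simp
      note u = u\<^sub>0[OF this]
      \<comment> \<open>The exponent exceeds by one the power \<open>3 * b\<close> of \<open>u\<close> in the cube of the decay constant.\<close>
      define X where "X = u powr (3 * b + 1)"
      have X: "1 \<le> X" unfolding X_def using u b by (intro ge_one_powr_ge_zero) auto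
      define q where "q = nat \<lceil>X\<rceil>"
      define S where "S = nat \<lceil>exp u\<rceil>"
      define P where "P = 60 * L * q * S"
      define N where "N = 5 * L * q * S"
      have V: "1 < exp u" using u by simp
      note par = ceiling_parameters[OF X V L(1), of M, folded q_def S_def, folded P_def N_def]
      have par: "X \<le> real q" "real q \<le> 2 * X" "2 \<le> S" "real P \<le> (exp u)\<^sup>2" "24 * M \<le> real P" "exp u \<le> real N"
        using par u by (simp_all add: X_def)
      have q0: "0 < q" and N0: "0 < N" using par X V by (auto intro: Suc_leI gr0I)
      have P0: "0 < P" using par(5) M by (auto intro: gr0I)
      \<comment> \<open>Although \<open>P\<close> is exponentially large in \<open>u\<close>, the loss in the ball condition at scale
        \<open>1 / P\<close> is bounded, because \<open>u\<close> times \<open>1 - \<alpha>\<close> is \<open>1\<close>.\<close>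
      have "real P powr (1 - \<alpha>) \<le> ((exp u)\<^sup>2) powr (1 - \<alpha>)"
        using par \<alpha> by (intro powr_mono2) auto
      also have "\<dots> = exp 2"
        using \<alpha> by (simp add: powr_def ln_realpow u_def field_simps)
      finally have PR: "real P powr (1 - \<alpha>) \<le> exp 2" .
      have cells: "measure \<mu> (cell P i) \<le> M / real P" for i
      proof -
        have "measure \<mu> (cell P i) \<le> C\<^sub>1 * exp 2 / real P"
          using measure_cell_le[OF \<mu>'(1,2) _ P0 PR] ball assms(1) by simp
        also have "\<dots> \<le> M / real P" using M P0 by (intro divide_right_mono) auto
        finally show ?thesis .
      qed
      have "1 / (10 ^ 15 * M ^ 3 * real L ^ 5 * real q ^ 3)
        \<le> (LINT (x, y, z)|triple \<mu>. fejer N (x + y - 2 * z) * ap_weight (q\<^sup>2) x z)"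
        unfolding N_def using par cells
        by (intro fejer_ap_mass_ge[OF \<mu>'(1,2) \<mu>01 M(1) _ _ L q0]) (auto simp: P_def)
      hence lower: "c / real q ^ 3 \<le> (LINT (x, y, z)|triple \<mu>. fejer N (x + y - 2 * z) * ap_weight (q\<^sup>2) x z)"
        by (simp add: c_def)
      define A where "A = (1 + C\<^sub>2) * u powr b"
      have A: "0 \<le> A" using assms(2) by (simp add: A_def)
      have A3: "A ^ 3 = K * u powr (3 * b)"
        using u by (simp add: A_def K_def power_mult_distrib powr_power mult.commute)
      have "(1 - \<alpha>) powr (- B) = u powr B" using \<alpha> by (simp add: u_def powr_divide powr_minus_divide)
      hence decay: "cmod (exp_mean \<mu> k) \<le> A * max 1 \<bar>real_of_int k\<bar> powr (- \<beta> / 2)" for k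
        unfolding A_def using four assms(2) b u by (intro exp_mean_decay[OF \<mu>'(1,2) \<mu>01]) auto
      have "c * X \<le> c * real q" using par c by (intro mult_left_mono) auto
      also have "\<dots> \<le> 3 * (1 + A ^ 3 * Z) + real q ^ 4 * (A ^ 3 * Z) * real N powr (- s)"
        unfolding s_def
        by (rule fejer_masses_incompatible[OF E no_AP \<mu> assms(3,4) decay A Z(2)[unfolded \<sigma>_def] q0 N0 lower])
      also have "\<dots> \<le> 3 * (1 + A ^ 3 * Z) + (2 * X) ^ 4 * (A ^ 3 * Z) * exp u powr (- s)"
        using par A Z(1) s by (intro add_left_mono mult_mono power_mono powr_mono2') auto
      also have "(2 * X) ^ 4 = 16 * u powr (12 * b + 4)"
        using u by (simp add: X_def power_mult_distrib powr_power algebra_simps)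
      also have "exp u powr (- s) = exp (- s * u)" by (simp add: powr_def)
      finally show False using u unfolding A3 X_def by linarith
    qed
  qed auto
qed

end
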